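(* Consider the Gaussian sequence experiment with information level $n$, $Y_j=\kappa_j\theta_j+n^{-1/2}\varepsilon_j$, $j\ge 1$, where the $\varepsilon_j\sim N(0,\sigma^2)$ and the $\theta_j\sim N(0,\tau_j^2)$ are all mutually independent, $\kappa_j>0$, $\tau_j>0$, $\sigma>0$. Let $a_j=\kappa_j^2\tau_j^2/\sigma^2$, enumerated so that $a_1\ge a_2\ge\cdots>0$. If $a_j\sim c\,j^{-q}$ as $j\to\infty$, with $q>1$ and $c>0$, then, as $n\to\infty$, \[ 2I(\theta;Y)\sim\pi c^{1/q}\csc\!\left(\frac{\pi}{q}\right)n^{1/q}, \] and \[ d_{\rm eff}(n)\sim\pi c^{1/q}\csc\!\left(\frac{\pi}{q}\right)\frac{n^{1/q}}{\log n}. \]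
   Context: $\theta=(\theta_j)_{j\ge1}$, $Y=(Y_j)_{j\ge1}$. $I(U;V)=\mathrm{KL}(P_{U,V}\,\|\,P_U\otimes P_V)$ denotes mutual information (natural logarithm), here under the joint prior–sampling law of $(\theta,Y)$ at information level $n$. The sequences $\kappa_j,\tau_j$ and $\sigma$ do not depend on $n$. Whenever $\sum_j a_j<\infty$ one has $2I(\theta;Y)=\sum_{j\ge1}\log(1+na_j)$. The Bayesian effective dimension is $d_{\rm eff}(n)=2I(\theta;Y)/\log n$ for $n\ge3$. The notation $f\sim g$ means $f/g\to1$. *)

theory Defs
  imports "HOL-Probability.Probability" "HOL-Library.Landau_Symbols"
begin

definition seq_obs ::
    "(nat \<Rightarrow> real) \<Rightarrow> (nat \<Rightarrow> 'a \<Rightarrow> real) \<Rightarrow> (nat \<Rightarrow> 'a \<Rightarrow> real) \<Rightarrow> real \<Rightarrow> nat \<Rightarrow> 'a \<Rightarrow> real" where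
  "seq_obs \<kappa> \<theta> \<epsilon> n j \<omega> = \<kappa> j * \<theta> j \<omega> + n powr (-1/2) * \<epsilon> j \<omega>"

text \<open>
  Sequences are indexed by \<open>j \<ge> 1\<close>, so a family of random variables is bundled into a random
  element of the product space over \<open>{1..}\<close>.  The value of a family at index \<open>0\<close> plays no role.
\<close>

abbreviation seq_space :: "(nat \<Rightarrow> real) measure" where
  "seq_space \<equiv> PiM {1..} (\<lambda>_. borel)"

definition as_seq :: "(nat \<Rightarrow> 'a \<Rightarrow> real) \<Rightarrow> 'a \<Rightarrow> nat \<Rightarrow> real" where
  "as_seq X \<omega> = (\<lambda>j\<in>{1..}. X j \<omega>)"

text \<open>
  The base \<open>exp 1\<close> gives natural logarithms.  The library's Kullback-Leibler divergence is a
  real number, with value \<open>0\<close> where the mathematical one is infinite; a nonzero value is always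
  the true divergence.
\<close>

definition seq_mutual_info ::
    "'a measure \<Rightarrow> (nat \<Rightarrow> real) \<Rightarrow> (nat \<Rightarrow> 'a \<Rightarrow> real) \<Rightarrow> (nat \<Rightarrow> 'a \<Rightarrow> real) \<Rightarrow> real \<Rightarrow> real" where
  "seq_mutual_info M \<kappa> \<theta> \<epsilon> n =
     prob_space.mutual_information M (exp 1) seq_space seq_space
       (as_seq \<theta>) (as_seq (seq_obs \<kappa> \<theta> \<epsilon> n))"

text \<open>Meaningful for \<open>n \<ge> 3\<close>.\<close>

definition eff_dim ::
    "'a measure \<Rightarrow> (nat \<Rightarrow> real) \<Rightarrow> (nat \<Rightarrow> 'a \<Rightarrow> real) \<Rightarrow> (nat \<Rightarrow> 'a \<Rightarrow> real) \<Rightarrow> real \<Rightarrow> real" where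
  "eff_dim M \<kappa> \<theta> \<epsilon> n = 2 * seq_mutual_info M \<kappa> \<theta> \<epsilon> n / ln n"

definition csc :: "real \<Rightarrow> real" where
  "csc x = 1 / sin x"

end

theory Submission
  imports Defs "HOL-Real_Asymp.Real_Asymp"
begin

text \<open>
  Regroup the two sequences into the independent pairs \<open>(\<theta>\<^sub>j, Y\<^sub>j)\<close>. The density ratio of such a
  pair with respect to the product of its marginals has second moment \<open>1 + n a\<^sub>j\<close> and mean logarithm
  \<open>ln (1 + n a\<^sub>j) / 2\<close>. As \<open>\<Sum> a\<^sub>j < \<infinity>\<close>, the partial products of the ratios form an
  \<open>L\<^sup>2\<close>-Cauchy sequence, whose limit is the density of the joint law with respect to the
  product law, and the relative entropy is the sum of the mean logarithms.

  For the asymptotics, \<open>n powr (- 1 / q) * (\<Sum>j\<ge>1. ln (1 + n a\<^sub>j))\<close> is exactly the integral over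
  \<open>u > 0\<close> of the step function \<open>ln (1 + n a\<^bsub>\<lceil>u n powr (1/q)\<rceil>\<^esub>)\<close>. This is dominated by
  \<open>ln (1 + C u powr (- q))\<close> and tends to \<open>ln (1 + c u powr (- q))\<close>, whose integral is a Beta value
  evaluated by the reflection formula.
\<close>

text \<open>Absolute continuity is not automatic on an infinite product: infinitely many mutually
  absolutely continuous factors can have mutually singular products. Hence a density of the joint
  law has to be produced before any entropy is evaluated. Second moments serve for this because in a
  Gaussian channel they are finite and explicit at every signal-to-noise ratio, and because they do
  double duty. Their products \<open>p n\<close> converge, which yields the density; and the ratios
  \<open>p' / p m\<close>, with \<open>p'\<close> the limit, bound the entropy that the first
  \<open>m\<close> coordinates miss. The second use is needed because convergence in mean of the
  partial ratios does not by itself control their logarithms.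

  In the step function, the ceiling makes the sum an exact integral, so that no comparison error has
  to be estimated. It also evaluates the sequence at an index not below
  \<open>u * n powr (1 / q)\<close>, so that one majorant serves all \<open>n > 0\<close> and
  \<open>u > 0\<close>; its singularity at zero is only logarithmic.\<close>

declare One_nat_def [simp del]

section \<open>Relative entropy of infinite product measures\<close>

text \<open>An almost everywhere convergent subsequence supplies \<open>g\<close>; Fatou's lemma in
  the subsequence index, with \<open>n\<close> fixed, then bounds the distance of \<open>s n\<close>
  from \<open>g\<close> by the Cauchy bound. Both modes of convergence are returned: the one in mean
  identifies a density, the pointwise one feeds further uses of Fatou's lemma.\<close>

lemma L1_Cauchy_limit:
  fixes s :: "nat \<Rightarrow> 'a \<Rightarrow> real"
  assumes int [measurable]: "\<And>n. integrable M (s n)"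
    and Cau: "\<And>e. e > 0 \<Longrightarrow> \<exists>N. \<forall>i\<ge>N. \<forall>j\<ge>N. (LINT x|M. norm (s i x - s j x)) < e"
  obtains r g where "strict_mono r" "integrable M g" "AE x in M. (\<lambda>i. s (r i) x) \<longlonglongrightarrow> g x"
    "(\<lambda>n. LINT x|M. norm (s n x - g x)) \<longlonglongrightarrow> 0"
proof -
  obtain r where r: "strict_mono r" and C: "AE x in M. Cauchy (\<lambda>i. s (r i) x)"
    using cauchy_L1_AE_cauchy_subseq[OF int Cau] by blast
  define g where "g x = lim (\<lambda>i. s (r i) x)" for x
  have g_meas [measurable]: "g \<in> borel_measurable M"
    unfolding g_def by (intro borel_measurable_lim_metric) auto
  have conv: "AE x in M. (\<lambda>i. s (r i) x) \<longlonglongrightarrow> g x"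
    using C by eventually_elim (auto simp: g_def Cauchy_convergent_iff convergent_LIMSEQ_iff)
  have nn: "\<exists>N. \<forall>n\<ge>N. (\<integral>\<^sup>+x. ennreal (norm (s n x - g x)) \<partial>M) \<le> ennreal e" if e: "e > 0" for e :: real
  proof -
    obtain N where N: "\<And>i j. i \<ge> N \<Longrightarrow> j \<ge> N \<Longrightarrow> (LINT x|M. norm (s i x - s j x)) < e"
      using Cau[OF e] by blast
    have "(\<integral>\<^sup>+x. ennreal (norm (s n x - g x)) \<partial>M) \<le> ennreal e" if n: "n \<ge> N" for n
    proof -
      have "(\<integral>\<^sup>+x. ennreal (norm (s n x - g x)) \<partial>M)
          = (\<integral>\<^sup>+x. liminf (\<lambda>i. ennreal (norm (s n x - s (r i) x))) \<partial>M)"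
      proof (rule nn_integral_cong_AE)
        show "AE x in M. ennreal (norm (s n x - g x)) = liminf (\<lambda>i. ennreal (norm (s n x - s (r i) x)))"
          using conv
        proof eventually_elim
          case (elim x)
          have "(\<lambda>i. ennreal (norm (s n x - s (r i) x))) \<longlonglongrightarrow> ennreal (norm (s n x - g x))"
            using elim by (intro tendsto_ennrealI tendsto_intros)
          then show ?case by (rule lim_imp_Liminf[OF sequentially_bot, symmetric])
        qed
      qed
      also have "\<dots> \<le> liminf (\<lambda>i. \<integral>\<^sup>+x. ennreal (norm (s n x - s (r i) x)) \<partial>M)"
        by (intro nn_integral_liminf) auto
      also have "\<dots> \<le> liminf (\<lambda>i. ennreal e)"
      proof (rule Liminf_mono)
        show "\<forall>\<^sub>F i in sequentially. (\<integral>\<^sup>+x. ennreal (norm (s n x - s (r i) x)) \<partial>M) \<le> ennreal e"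
          using eventually_ge_at_top[of N]
        proof eventually_elim
          case (elim i)
          have "r i \<ge> N" using seq_suble[OF r, of i] elim by simp
          have "(\<integral>\<^sup>+x. ennreal (norm (s n x - s (r i) x)) \<partial>M) = ennreal (LINT x|M. norm (s n x - s (r i) x))"
            by (intro nn_integral_eq_integral) (auto intro!: integrable_norm Bochner_Integration.integrable_diff int)
          also have "\<dots> \<le> ennreal e"
            using N[OF n \<open>r i \<ge> N\<close>] by (intro ennreal_leI) auto
          finally show ?case .
        qed
      qed
      also have "\<dots> = ennreal e" by (simp add: Liminf_const)
      finally show ?thesis .
    qed
    then show ?thesis by blast
  qed
  have int_diff: "integrable M (\<lambda>x. s n x - g x)" if "(\<integral>\<^sup>+x. ennreal (norm (s n x - g x)) \<partial>M) \<le> ennreal e" for n e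
    using that by (intro integrableI_bounded) (auto simp: top.not_eq_extremum intro: le_less_trans)
  obtain N1 where "(\<integral>\<^sup>+x. ennreal (norm (s N1 x - g x)) \<partial>M) \<le> ennreal 1"
    using nn[of 1] by auto
  from Bochner_Integration.integrable_diff[OF int[of N1] int_diff[OF this]]
  have g_int: "integrable M g" by simp
  have "(\<lambda>n. LINT x|M. norm (s n x - g x)) \<longlonglongrightarrow> 0"
  proof (rule LIMSEQ_I)
    fix e :: real assume "e > 0"
    then obtain N where N: "\<And>n. n \<ge> N \<Longrightarrow> (\<integral>\<^sup>+x. ennreal (norm (s n x - g x)) \<partial>M) \<le> ennreal (e / 2)"
      using nn[of "e / 2"] by auto
    have "norm ((LINT x|M. norm (s n x - g x)) - 0) < e" if "n \<ge> N" for n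
    proof -
      have "(\<integral>\<^sup>+x. ennreal (norm (s n x - g x)) \<partial>M) = ennreal (LINT x|M. norm (s n x - g x))"
        by (intro nn_integral_eq_integral) (auto intro!: integrable_norm Bochner_Integration.integrable_diff int g_int)
      with N[OF that] have "(LINT x|M. norm (s n x - g x)) \<le> e / 2"
        using \<open>e > 0\<close> by (simp add: ennreal_le_iff)
      moreover have "(LINT x|M. norm (s n x - g x)) \<ge> 0" by (intro integral_nonneg_AE) auto
      ultimately show ?thesis using \<open>e > 0\<close> by simp
    qed
    then show "\<exists>N. \<forall>n\<ge>N. norm ((LINT x|M. norm (s n x - g x)) - 0) < e" by blast
  qed
  with r g_int conv show thesis using that by blast
qed

text \<open>The joint map of the coordinates is the identity on the space, so its law is the product
  of the coordinate laws, which characterises independence.\<close>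

lemma indep_vars_PiM_component:
  assumes "\<And>i. i \<in> I \<Longrightarrow> prob_space (M i)" "I \<noteq> {}"
  shows "prob_space.indep_vars (PiM I M) M (\<lambda>i x. x i) I"
proof -
  interpret prob_space "PiM I M" by (intro prob_space_PiM assms)
  have "distr (PiM I M) (PiM I M) (\<lambda>x. \<lambda>i\<in>I. x i) = distr (PiM I M) (PiM I M) (\<lambda>x. x)"
    by (intro distr_cong) (auto simp: space_PiM)
  also have "\<dots> = PiM I M" by simp
  also have "\<dots> = PiM I (\<lambda>i. distr (PiM I M) (M i) (\<lambda>x. x i))"
    using assms by (intro PiM_cong) (auto simp: distr_PiM_component)
  finally show ?thesis
    using assms by (subst indep_vars_iff_distr_eq_PiM') auto
qed

text \<open>Functions of distinct coordinates are independent, so the integral factorises.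
  \<open>I\<close> may be infinite; this is how integrals of finitely many coordinates are computed
  over the infinite product.\<close>

lemma nn_integral_PiM_prod:
  fixes g :: "'i \<Rightarrow> 'a \<Rightarrow> ennreal"
  assumes M: "\<And>i. i \<in> I \<Longrightarrow> prob_space (M i)" and J: "finite J" "J \<subseteq> I"
    and g: "\<And>i. i \<in> J \<Longrightarrow> g i \<in> borel_measurable (M i)"
  shows "(\<integral>\<^sup>+x. (\<Prod>i\<in>J. g i (x i)) \<partial>PiM I M) = (\<Prod>i\<in>J. \<integral>\<^sup>+x. g i x \<partial>M i)"
proof -
  interpret prob_space "PiM I M" by (intro prob_space_PiM M)
  show ?thesis
  proof (cases "J = {}")
    case True
    then show ?thesis by (simp add: emeasure_space_1)
  next
    case False
    then have "I \<noteq> {}" using J by auto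
    then have "indep_vars M (\<lambda>i x. x i) J"
      using indep_vars_PiM_component[of I M] M J(2) indep_vars_subset by blast
    then have "indep_vars (\<lambda>_. borel) (\<lambda>i x. g i (x i)) J"
      by (rule indep_vars_compose2) (use g in auto)
    then have "(\<integral>\<^sup>+x. (\<Prod>i\<in>J. g i (x i)) \<partial>PiM I M) = (\<Prod>i\<in>J. \<integral>\<^sup>+x. g i (x i) \<partial>PiM I M)"
      by (intro indep_vars_nn_integral J) auto
    also have "\<dots> = (\<Prod>i\<in>J. \<integral>\<^sup>+x. g i x \<partial>M i)"
    proof (rule prod.cong[OF refl])
      fix i assume i: "i \<in> J"
      then have "i \<in> I" using J by auto
      have "(\<integral>\<^sup>+x. g i x \<partial>M i) = (\<integral>\<^sup>+x. g i x \<partial>distr (PiM I M) (M i) (\<lambda>x. x i))"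
        using distr_PiM_component[of I M i] M \<open>i \<in> I\<close> by simp
      also have "\<dots> = (\<integral>\<^sup>+x. g i (x i) \<partial>PiM I M)"
        using g[OF i] \<open>i \<in> I\<close> by (intro nn_integral_distr) auto
      finally show "(\<integral>\<^sup>+x. g i (x i) \<partial>PiM I M) = (\<integral>\<^sup>+x. g i x \<partial>M i)" ..
    qed
    finally show ?thesis .
  qed
qed

section \<open>Moments of the partial likelihood ratios\<close>

text \<open>\<open>Q j\<close> stands for the product of the marginals of the \<open>j\<close>-th
  pair, \<open>f j\<close> for its density ratio, and \<open>b j\<close> is the chi-square
  divergence of \<open>density (Q j) (f j)\<close> from \<open>Q j\<close>. Positivity of
  \<open>f j\<close> everywhere lets logarithms of products split without exceptional sets.\<close>

locale product_density_ratio =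
  fixes Q :: "nat \<Rightarrow> 'a measure" and f :: "nat \<Rightarrow> 'a \<Rightarrow> real" and b :: "nat \<Rightarrow> real"
  assumes prob_Q: "j \<ge> 1 \<Longrightarrow> prob_space (Q j)"
    and f_meas: "j \<ge> 1 \<Longrightarrow> f j \<in> borel_measurable (Q j)"
    and f_pos: "j \<ge> 1 \<Longrightarrow> f j x > 0"
    and f_int: "j \<ge> 1 \<Longrightarrow> (\<integral>\<^sup>+x. f j x \<partial>Q j) = 1"
    and f_sq: "j \<ge> 1 \<Longrightarrow> (\<integral>\<^sup>+x. (f j x)\<^sup>2 \<partial>Q j) = ennreal (1 + b j)"
    and b_nonneg: "j \<ge> 1 \<Longrightarrow> b j \<ge> 0"
    and b_summable: "summable (\<lambda>j. b (Suc j))"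
begin

abbreviation "P j \<equiv> density (Q j) (f j)"
abbreviation "QQ \<equiv> PiM {1..} Q"
abbreviation "PP \<equiv> PiM {1..} P"

text \<open>The likelihood ratio of the first \<open>n\<close> coordinates, a martingale under
  \<open>QQ\<close>.\<close>

definition L :: "nat \<Rightarrow> (nat \<Rightarrow> 'a) \<Rightarrow> real" where
  "L n x = (\<Prod>j\<in>{1..n}. f j (x j))"

text \<open>The second moment of \<open>L n\<close> under \<open>QQ\<close>.\<close>

definition p :: "nat \<Rightarrow> real" where
  "p n = (\<Prod>j\<in>{1..n}. 1 + b j)"

lemma prob_P: "j \<ge> 1 \<Longrightarrow> prob_space (P j)"
  using f_int f_meas prob_Q
  by (intro prob_spaceI) (simp add: emeasure_density cong: nn_integral_cong_simp)

sublocale QQ: prob_space QQ by (intro prob_space_PiM prob_Q) auto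
sublocale PP: prob_space PP by (intro prob_space_PiM prob_P) auto

lemma sets_PP [measurable_cong]: "sets PP = sets QQ"
  by (intro sets_PiM_cong) auto

lemma f_comp_meas: "j \<ge> 1 \<Longrightarrow> (\<lambda>x. f j (x j)) \<in> borel_measurable QQ"
  by (rule measurable_compose[OF _ f_meas]) auto

lemma L_meas [measurable]: "L n \<in> borel_measurable QQ"
  unfolding L_def using f_comp_meas by (intro borel_measurable_prod) auto

lemma L_pos: "L n x > 0"
  unfolding L_def using f_pos by (intro prod_pos) auto

lemma p_pos: "p n > 0"
  unfolding p_def using b_nonneg by (intro prod_pos) (force intro: add_pos_nonneg)

lemma p_mono: "m \<le> n \<Longrightarrow> p m \<le> p n"
  unfolding p_def using b_nonneg by (intro prod_mono2) auto

text \<open>The sequence increases and is bounded, by \<open>1 + x \<le> exp x\<close> in each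
  factor. Summability of \<open>b\<close> enters the argument here.\<close>

lemma p_convergent: "convergent p"
proof -
  have "p n \<le> exp (\<Sum>j. b (Suc j))" for n
  proof -
    have "p n = (\<Prod>j<n. 1 + b (Suc j))"
      unfolding p_def by (simp add: prod.atLeast1_atMost_eq One_nat_def)
    also have "\<dots> \<le> (\<Prod>j<n. exp (b (Suc j)))"
      using b_nonneg by (intro prod_mono) (auto intro!: exp_ge_add_one_self add_nonneg_nonneg simp: One_nat_def)
    also have "\<dots> = exp (\<Sum>j<n. b (Suc j))"
      by (simp add: exp_sum)
    also have "\<dots> \<le> exp (\<Sum>j. b (Suc j))"
      using b_nonneg b_summable by (auto intro!: sum_le_suminf simp: One_nat_def)
    finally show ?thesis .
  qed
  then show ?thesis
    using p_mono p_pos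
    by (intro Bseq_mono_convergent BseqI') (auto simp: abs_of_pos)
qed

text \<open>A factor with exponent one integrates to 1, so only the squared ones, indexed by
  \<open>K\<close>, remain. The choices \<open>{}\<close>, \<open>{1..m}\<close> and
  \<open>{m<..n}\<close> for \<open>K\<close> give the mass of \<open>L n\<close>, the mixed moment
  of \<open>L m\<close> and \<open>L n\<close>, and the integral of
  \<open>(L n)\<^sup>2 / L m\<close>.\<close>

lemma nn_integral_f_powers:
  assumes "finite J" "J \<subseteq> {1..}" "K \<subseteq> J"
  shows "(\<integral>\<^sup>+x. ennreal (\<Prod>j\<in>J. if j \<in> K then (f j (x j))\<^sup>2 else f j (x j)) \<partial>QQ)
    = ennreal (\<Prod>j\<in>K. 1 + b j)"
proof -
  have "(\<integral>\<^sup>+x. ennreal (\<Prod>j\<in>J. if j \<in> K then (f j (x j))\<^sup>2 else f j (x j)) \<partial>QQ)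
    = (\<integral>\<^sup>+x. (\<Prod>j\<in>J. ennreal (if j \<in> K then (f j (x j))\<^sup>2 else f j (x j))) \<partial>QQ)"
    using assms f_pos by (intro nn_integral_cong, subst prod_ennreal) (auto intro!: less_imp_le[OF f_pos])
  also have "\<dots> = (\<Prod>j\<in>J. \<integral>\<^sup>+x. ennreal (if j \<in> K then (f j x)\<^sup>2 else f j x) \<partial>Q j)"
  proof (rule nn_integral_PiM_prod[OF prob_Q, where g = "\<lambda>j x. ennreal (if j \<in> K then (f j x)\<^sup>2 else f j x)"])
    show "(\<lambda>x. ennreal (if j \<in> K then (f j x)\<^sup>2 else f j x)) \<in> borel_measurable (Q j)" if "j \<in> J" for j
      using f_meas[of j] that assms by (cases "j \<in> K") auto
  qed (use assms in auto)
  also have "\<dots> = (\<Prod>j\<in>J. if j \<in> K then ennreal (1 + b j) else 1)"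
    using assms f_int f_sq by (intro prod.cong) auto
  also have "\<dots> = (\<Prod>j\<in>K. ennreal (1 + b j))"
    using assms by (subst prod.If_cases) (auto simp: Int_absorb1)
  also have "\<dots> = ennreal (\<Prod>j\<in>K. 1 + b j)"
    using assms b_nonneg by (intro prod_ennreal) force
  finally show ?thesis .
qed

lemma prod_split: "(m::nat) \<le> n \<Longrightarrow> (\<Prod>j\<in>{1..n}. h j) = (\<Prod>j\<in>{1..m}. h j) * (\<Prod>j\<in>{m<..n}. h j :: 'b :: comm_monoid_mult)"
proof -
  assume "m \<le> n"
  then have *: "{1..n} = {1..m} \<union> {m<..n}" by auto
  show ?thesis unfolding * by (rule prod.union_disjoint) auto
qed

lemma nn_integral_L: "(\<integral>\<^sup>+x. L n x \<partial>QQ) = 1"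
  using nn_integral_f_powers[of "{1..n}" "{}"] by (simp add: L_def)

text \<open>The coordinates beyond \<open>m\<close> occur only in \<open>L n\<close>, with exponent
  one, and integrate out: the martingale property in integrated form.\<close>

lemma nn_integral_L_mult:
  assumes "m \<le> n"
  shows "(\<integral>\<^sup>+x. L m x * L n x \<partial>QQ) = ennreal (p m)"
proof -
  have "L m x * L n x = (\<Prod>j\<in>{1..n}. if j \<in> {1..m} then (f j (x j))\<^sup>2 else f j (x j))" for x
  proof -
    have "(\<Prod>j\<in>{1..n}. if j \<in> {1..m} then (f j (x j))\<^sup>2 else f j (x j))
       = (\<Prod>j\<in>{1..m}. (f j (x j))\<^sup>2) * (\<Prod>j\<in>{m<..n}. f j (x j))"
      unfolding prod_split[OF assms] by (intro arg_cong2[where f = "(*)"] prod.cong) auto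
    then show ?thesis
      unfolding L_def prod_split[OF assms]
      by (simp add: prod_power_distrib power2_eq_square prod.distrib mult_ac)
  qed
  then show ?thesis
    using nn_integral_f_powers[of "{1..n}" "{1..m}"] assms by (simp add: p_def)
qed

text \<open>Relative to the measure with density \<open>L m\<close>, the measure with density
  \<open>L n\<close> has density \<open>L n / L m\<close>; the integral is the second moment of that
  density, so \<open>p n / p m - 1\<close> is a chi-square divergence. It will bound the entropy
  beyond coordinate \<open>m\<close>.\<close>

lemma nn_integral_L_sq_div:
  assumes "m \<le> n"
  shows "(\<integral>\<^sup>+x. (L n x)\<^sup>2 / L m x \<partial>QQ) = ennreal (p n / p m)"
proof -
  have "(L n x)\<^sup>2 / L m x = (\<Prod>j\<in>{1..n}. if j \<in> {m<..n} then (f j (x j))\<^sup>2 else f j (x j))" for x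
  proof -
    have "(\<Prod>j\<in>{1..n}. if j \<in> {m<..n} then (f j (x j))\<^sup>2 else f j (x j))
       = (\<Prod>j\<in>{1..m}. f j (x j)) * (\<Prod>j\<in>{m<..n}. (f j (x j))\<^sup>2)"
      unfolding prod_split[OF assms] by (intro arg_cong2[where f = "(*)"] prod.cong) auto
    moreover have "L m x \<noteq> 0" using L_pos[of m x] by simp
    ultimately show ?thesis
      unfolding L_def prod_split[OF assms]
      by (simp add: prod_power_distrib power2_eq_square prod.distrib field_simps)
  qed
  moreover have "(\<Prod>j\<in>{m<..n}. 1 + b j) = p n / p m"
    using less_imp_neq[OF p_pos[of m]] unfolding p_def prod_split[OF assms]
    by (simp add: nonzero_eq_divide_eq mult.commute)
  moreover have "{m<..n} \<subseteq> {1..n}" by auto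
  ultimately show ?thesis
    using nn_integral_f_powers[of "{1..n}" "{m<..n}"] by simp
qed

lemma L_integrable: "integrable QQ (L n)" and L_integral: "(\<integral>x. L n x \<partial>QQ) = 1"
  using nn_integral_L[of n] L_pos
    nn_integral_eq_integrable[of "L n" QQ 1] by (auto simp: less_imp_le)

lemma L_mult_integrable: "integrable QQ (\<lambda>x. L m x * L n x)"
  and L_mult_integral: "m \<le> n \<Longrightarrow> (\<integral>x. L m x * L n x \<partial>QQ) = p m"
proof -
  have *: "integrable QQ (\<lambda>x. L m x * L n x) \<and> (\<integral>x. L m x * L n x \<partial>QQ) = p m" if "m \<le> n" for m n
    using nn_integral_L_mult[OF that] L_pos p_pos[of m]
    by (subst nn_integral_eq_integrable[symmetric]) (auto simp: less_imp_le)
  show "integrable QQ (\<lambda>x. L m x * L n x)"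
    using *[of m n] *[of n m] by (cases "m \<le> n") (auto simp: mult.commute)
  show "m \<le> n \<Longrightarrow> (\<integral>x. L m x * L n x \<partial>QQ) = p m" using * by blast
qed

text \<open>Expanding the square gives \<open>p n - 2 * p m + p m\<close> by the mixed moments, and
  nonnegativity of the variance of the absolute difference passes from the second moment to the
  first.\<close>

lemma L_diff_L1:
  assumes "m \<le> n"
  shows "(\<integral>x. \<bar>L n x - L m x\<bar> \<partial>QQ)\<^sup>2 \<le> p n - p m"
proof -
  have eq: "(\<lambda>x. \<bar>L n x - L m x\<bar>\<^sup>2) = (\<lambda>x. L n x * L n x - 2 * (L m x * L n x) + L m x * L m x)"
    by (auto simp: power2_eq_square algebra_simps)
  have sq: "integrable QQ (\<lambda>x. \<bar>L n x - L m x\<bar>\<^sup>2)"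
    unfolding eq by (intro Bochner_Integration.integrable_add Bochner_Integration.integrable_diff integrable_mult_right L_mult_integrable)
  have "(\<integral>x. \<bar>L n x - L m x\<bar>\<^sup>2 \<partial>QQ) = p n - p m"
    unfolding eq using assms
    by (subst Bochner_Integration.integral_add Bochner_Integration.integral_diff integral_mult_right,
        (intro Bochner_Integration.integrable_add Bochner_Integration.integrable_diff integrable_mult_right L_mult_integrable)+)+
       (simp add: L_mult_integral[OF assms] L_mult_integral[OF order.refl])
  moreover have "0 \<le> QQ.variance (\<lambda>x. \<bar>L n x - L m x\<bar>)"
    by (rule QQ.variance_positive)
  moreover have "QQ.variance (\<lambda>x. \<bar>L n x - L m x\<bar>)
    = (\<integral>x. \<bar>L n x - L m x\<bar>\<^sup>2 \<partial>QQ) - (\<integral>x. \<bar>L n x - L m x\<bar> \<partial>QQ)\<^sup>2"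
    by (intro QQ.variance_eq sq) (auto intro!: integrable_abs Bochner_Integration.integrable_diff L_integrable)
  ultimately show ?thesis by simp
qed

lemma L_Cauchy:
  assumes "e > 0"
  shows "\<exists>N. \<forall>i\<ge>N. \<forall>j\<ge>N. (\<integral>x. norm (L i x - L j x) \<partial>QQ) < e"
proof -
  have "Cauchy p" using p_convergent by (simp add: Cauchy_convergent_iff)
  then obtain N where N: "\<And>i j. i \<ge> N \<Longrightarrow> j \<ge> N \<Longrightarrow> \<bar>p i - p j\<bar> < e\<^sup>2"
    using assms unfolding Cauchy_def dist_real_def by (meson zero_less_power)
  have *: "(\<integral>x. norm (L i x - L j x) \<partial>QQ) < e" if "i \<ge> N" "j \<ge> N" "j \<le> i" for i j
    using L_diff_L1[OF that(3)] N[OF that(1,2)] assms by (intro power2_less_imp_less[of _ e]) auto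
  have "(\<integral>x. norm (L i x - L j x) \<partial>QQ) < e" if "i \<ge> N" "j \<ge> N" for i j
    using *[of i j] *[of j i] that by (cases "j \<le> i") (auto simp: abs_minus_commute)
  then show ?thesis by blast
qed

section \<open>The density of the infinite product\<close>

text \<open>The indicator of the cylinder is a product over \<open>J\<close>, so it can be absorbed
  into the factors \<open>f j\<close>; coordinates of \<open>{1..n}\<close> outside \<open>J\<close>
  contribute 1. Cylinders determine a measure on the product, so these identities suffice to
  recognise the density in the limit.\<close>

lemma PP_emb:
  assumes "finite J" "J \<subseteq> {1..}" "\<And>j. j \<in> J \<Longrightarrow> A j \<in> sets (Q j)" "J \<subseteq> {1..n}"
  shows "emeasure PP (prod_emb {1..} Q J (Pi\<^sub>E J A))
    = (\<integral>\<^sup>+x. ennreal (L n x) * indicator (prod_emb {1..} Q J (Pi\<^sub>E J A)) x \<partial>QQ)"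
proof -
  define g where "g j x = ennreal (f j x) * (if j \<in> J then indicator (A j) x else 1)" for j x
  have g_meas: "g j \<in> borel_measurable (Q j)" if "j \<in> {1..n}" for j
    using f_meas[of j] that assms(3)[of j] unfolding g_def by (cases "j \<in> J") auto
  have eq: "ennreal (L n x) * indicator (prod_emb {1..} Q J (Pi\<^sub>E J A)) x = (\<Prod>j\<in>{1..n}. g j (x j))"
    if x: "x \<in> space QQ" for x
  proof -
    have "(\<Prod>j\<in>{1..n}. g j (x j))
      = (\<Prod>j\<in>{1..n}. ennreal (f j (x j))) * (\<Prod>j\<in>{1..n}. if j \<in> J then indicator (A j) (x j) else 1)"
      unfolding g_def by (simp add: prod.distrib)
    also have "(\<Prod>j\<in>{1..n}. ennreal (f j (x j))) = ennreal (L n x)"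
      unfolding L_def by (intro prod_ennreal) (auto intro!: less_imp_le[OF f_pos])
    also have "(\<Prod>j\<in>{1..n}. if j \<in> J then indicator (A j) (x j) else 1)
        = (\<Prod>j\<in>J. indicator (A j) (x j) :: ennreal)"
      using assms(4) by (subst prod.inter_restrict[symmetric]) (auto simp: Int_absorb1)
    also have "(\<Prod>j\<in>J. indicator (A j) (x j) :: ennreal) = indicator (prod_emb {1..} Q J (Pi\<^sub>E J A)) x"
    proof (cases "\<forall>j\<in>J. x j \<in> A j")
      case True
      then have "x \<in> prod_emb {1..} Q J (Pi\<^sub>E J A)"
        using x by (auto simp: prod_emb_def space_PiM)
      then show ?thesis using True by simp
    next
      case False
      then have "x \<notin> prod_emb {1..} Q J (Pi\<^sub>E J A)" by (auto simp: prod_emb_def)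
      moreover have "(\<Prod>j\<in>J. indicator (A j) (x j) :: ennreal) = 0"
        using False assms(1) by (auto simp: prod_zero_iff indicator_eq_0_iff)
      ultimately show ?thesis by simp
    qed
    finally show ?thesis by simp
  qed
  have "(\<integral>\<^sup>+x. ennreal (L n x) * indicator (prod_emb {1..} Q J (Pi\<^sub>E J A)) x \<partial>QQ)
      = (\<integral>\<^sup>+x. (\<Prod>j\<in>{1..n}. g j (x j)) \<partial>QQ)"
    by (intro nn_integral_cong eq)
  also have "\<dots> = (\<Prod>j\<in>{1..n}. \<integral>\<^sup>+x. g j x \<partial>Q j)"
    by (rule nn_integral_PiM_prod[OF prob_Q]) (auto intro: g_meas)
  also have "\<dots> = (\<Prod>j\<in>{1..n}. if j \<in> J then emeasure (P j) (A j) else 1)"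
  proof (intro prod.cong refl)
    fix j assume "j \<in> {1..n}"
    then show "(\<integral>\<^sup>+x. g j x \<partial>Q j) = (if j \<in> J then emeasure (P j) (A j) else 1)"
      using f_meas[of j] f_int[of j] assms(3)[of j] by (auto simp: g_def emeasure_density)
  qed
  also have "\<dots> = (\<Prod>j\<in>J. emeasure (P j) (A j))"
    using assms(4) by (subst prod.inter_restrict[symmetric]) (auto simp: Int_absorb1)
  also have "\<dots> = emeasure PP (prod_emb {1..} P J (Pi\<^sub>E J A))"
    using assms prob_P by (subst emeasure_PiM_emb) auto
  also have "prod_emb {1..} P J (Pi\<^sub>E J A) = prod_emb {1..} Q J (Pi\<^sub>E J A)"
    by (simp add: prod_emb_def)
  finally show ?thesis ..
qed

text \<open>For a fixed cylinder the integrals of \<open>L n\<close> are constant once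
  \<open>{1..n}\<close> contains its base, and equal the mass under \<open>PP\<close>; convergence
  in mean carries the identity to the limit \<open>l\<close>. Agreement on all cylinders gives
  equality of the measures.\<close>

lemma L_limit:
  obtains r l where "strict_mono r" "integrable QQ l" "\<And>x. l x \<ge> 0"
    "AE x in QQ. (\<lambda>i. L (r i) x) \<longlonglongrightarrow> l x" "PP = density QQ (\<lambda>x. ennreal (l x))"
proof -
  obtain r l0 where r: "strict_mono r" and l0: "integrable QQ l0" 
    and lim0: "AE x in QQ. (\<lambda>i. L (r i) x) \<longlonglongrightarrow> l0 x"
    and L1_0: "(\<lambda>n. \<integral>x. norm (L n x - l0 x) \<partial>QQ) \<longlonglongrightarrow> 0"
    using L1_Cauchy_limit[OF L_integrable L_Cauchy] by blast
  \<comment> \<open>The limit is nonnegative only almost everywhere; truncation makes this hold at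
    every point.\<close>
  define l where "l x = max 0 (l0 x)" for x
  have l: "integrable QQ l" unfolding l_def using l0 by (intro integrable_max) auto
  note [measurable] = borel_measurable_integrable[OF l]
  have lim: "AE x in QQ. (\<lambda>i. L (r i) x) \<longlonglongrightarrow> l x"
    using lim0
  proof eventually_elim
    case (elim x)
    then have "l0 x \<ge> 0"
      using L_pos by (intro LIMSEQ_le_const[OF elim]) (auto intro: less_imp_le)
    then show ?case using elim by (simp add: l_def max_def)
  qed
  have "AE x in QQ. l x = l0 x"
    using lim lim0 by eventually_elim (rule LIMSEQ_unique)
  then have "(\<integral>x. norm (L n x - l0 x) \<partial>QQ) = (\<integral>x. norm (L n x - l x) \<partial>QQ)" for n
    using l0 by (intro integral_cong_AE) auto
  with L1_0 have L1: "(\<lambda>n. \<integral>x. norm (L n x - l x) \<partial>QQ) \<longlonglongrightarrow> 0" by simp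
  have "PP = density QQ (\<lambda>x. ennreal (l x))"
  proof (rule measure_eqI_PiM_infinite[where M = Q and I = "{1..}"])
    fix A J assume J: "finite J" "J \<subseteq> {1..}" and A: "\<And>j. j \<in> J \<Longrightarrow> A j \<in> sets (Q j)"
    define E where "E = prod_emb {1..} Q J (Pi\<^sub>E J A)"
    have E [measurable]: "E \<in> sets QQ"
      unfolding E_def using J A by (intro sets_PiM_I) auto
    have intE: "integrable QQ (\<lambda>x. h x * indicator E x)" if "integrable QQ h" for h :: "_ \<Rightarrow> real"
      using integrable_mult_indicator[OF E that] by (simp add: mult.commute)
    obtain n0 where n0: "J \<subseteq> {1..n0}"
      using J finite_nat_set_iff_bounded_le[of J] by fastforce
    have L_E: "(\<integral>x. L n x * indicator E x \<partial>QQ) = measure PP E" if "n \<ge> n0" for n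
    proof -
      have "J \<subseteq> {1..n}" using n0 that by force
      then have "emeasure PP E = (\<integral>\<^sup>+x. ennreal (L n x * indicator E x) \<partial>QQ)"
        unfolding E_def using PP_emb[OF J A, of n] L_pos
        by (simp add: ennreal_mult'' ennreal_indicator)
      also have "\<dots> = ennreal (\<integral>x. L n x * indicator E x \<partial>QQ)"
        by (intro nn_integral_eq_integral intE L_integrable)
           (auto intro!: mult_nonneg_nonneg less_imp_le[OF L_pos])
      finally show ?thesis
        by (simp add: measure_def integral_nonneg_AE less_imp_le[OF L_pos])
    qed
    have "(\<lambda>n. \<integral>x. L n x * indicator E x \<partial>QQ) \<longlonglongrightarrow> (\<integral>x. l x * indicator E x \<partial>QQ)"
    proof (rule LIM_zero_cancel, rule Lim_null_comparison[OF _ L1], rule always_eventually, rule allI)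
      fix n
      have "(\<integral>x. L n x * indicator E x \<partial>QQ) - (\<integral>x. l x * indicator E x \<partial>QQ)
          = (\<integral>x. L n x * indicator E x - l x * indicator E x \<partial>QQ)"
        by (intro Bochner_Integration.integral_diff[symmetric] intE L_integrable l)
      also have "norm \<dots> \<le> (\<integral>x. norm (L n x * indicator E x - l x * indicator E x) \<partial>QQ)"
        by (rule integral_norm_bound)
      also have "\<dots> \<le> (\<integral>x. norm (L n x - l x) \<partial>QQ)"
        by (intro integral_mono integrable_norm Bochner_Integration.integrable_diff intE L_integrable l)
           (auto simp: indicator_def)
      finally show "norm ((\<integral>x. L n x * indicator E x \<partial>QQ) - (\<integral>x. l x * indicator E x \<partial>QQ))
        \<le> (\<integral>x. norm (L n x - l x) \<partial>QQ)" .
    qed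
    moreover have "(\<lambda>n. \<integral>x. L n x * indicator E x \<partial>QQ) \<longlonglongrightarrow> measure PP E"
      using L_E by (intro tendsto_eventually) (auto simp: eventually_at_top_linorder)
    ultimately have "measure PP E = (\<integral>x. l x * indicator E x \<partial>QQ)"
      by (rule LIMSEQ_unique[rotated])
    then have "emeasure PP E = ennreal (\<integral>x. l x * indicator E x \<partial>QQ)"
      by (simp add: PP.emeasure_eq_measure)
    also have "\<dots> = (\<integral>\<^sup>+x. ennreal (l x * indicator E x) \<partial>QQ)"
      by (intro nn_integral_eq_integral[symmetric] intE l) (auto simp: l_def)
    also have "\<dots> = emeasure (density QQ (\<lambda>x. ennreal (l x))) E"
      by (simp add: emeasure_density ennreal_mult'' ennreal_indicator)
    finally show "emeasure PP (prod_emb {1..} Q J (Pi\<^sub>E J A))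
      = emeasure (density QQ (\<lambda>x. ennreal (l x))) (prod_emb {1..} Q J (Pi\<^sub>E J A))"
      unfolding E_def .
  qed (simp_all add: sets_PP PP.finite_measure)
  with that[OF r l _ lim] show thesis by (simp add: l_def)
qed

section \<open>Relative entropy of the infinite product\<close>

text \<open>Applying \<open>ln t \<le> t - 1\<close> to \<open>f\<close> and to \<open>1 / f\<close>
  gives \<open>f - 1 \<le> f * ln f \<le> f\<^sup>2 - f\<close>, so the finite second moment
  dominates the integrand under \<open>Q j\<close>.\<close>

lemma ln_f_integrable:
  assumes "j \<ge> 1"
  shows "integrable (P j) (\<lambda>x. ln (f j x))"
proof -
  interpret Qj: prob_space "Q j" by (rule prob_Q[OF assms])
  note [measurable] = f_meas[OF assms]
  have pos: "f j x > 0" for x by (rule f_pos[OF assms])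
  have "integrable (Q j) (\<lambda>x. (f j x)\<^sup>2)"
    using f_sq[OF assms] by (intro integrableI_nn_integral_finite) auto
  then have "integrable (Q j) (\<lambda>x. (f j x)\<^sup>2 + 1)" by auto
  then have "integrable (Q j) (\<lambda>x. f j x * ln (f j x))"
  proof (rule Bochner_Integration.integrable_bound)
    show "AE x in Q j. norm (f j x * ln (f j x)) \<le> norm ((f j x)\<^sup>2 + 1)"
    proof (rule AE_I2)
      fix x
      have "f j x * ln (f j x) \<le> f j x * (f j x - 1)"
        using pos[of x] by (intro mult_left_mono ln_le_minus_one) auto
      moreover have "f j x * (1 - 1 / f j x) \<le> f j x * ln (f j x)"
        using pos[of x] ln_le_minus_one[of "1 / f j x"] by (intro mult_left_mono) (auto simp: ln_div)
      ultimately show "norm (f j x * ln (f j x)) \<le> norm ((f j x)\<^sup>2 + 1)"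
        using pos[of x] by (auto simp: abs_le_iff power2_eq_square algebra_simps)
          (smt (verit) mult_pos_pos)
    qed
  qed auto
  then show ?thesis
    by (subst integrable_density) (auto intro!: less_imp_le[OF pos])
qed

lemma ln_L_integrable: "integrable PP (\<lambda>x. ln (L n x))"
  and ln_L_integral: "(\<integral>x. ln (L n x) \<partial>PP) = (\<Sum>j\<in>{1..n}. \<integral>x. ln (f j x) \<partial>P j)"
proof -
  have eq: "(\<lambda>x. ln (L n x)) = (\<lambda>x. \<Sum>j\<in>{1..n}. ln (f j (x j)))"
    unfolding L_def by (intro ext ln_prod) (auto simp: less_imp_neq[OF f_pos, symmetric])
  have *: "integrable PP (\<lambda>x. ln (f j (x j))) \<and> (\<integral>x. ln (f j (x j)) \<partial>PP) = (\<integral>x. ln (f j x) \<partial>P j)"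
    if "j \<in> {1..n}" for j
  proof -
    have j: "j \<ge> 1" using that by auto
    note [measurable] = f_meas[OF j]
    have d: "distr PP (P j) (\<lambda>x. x j) = P j"
      using prob_P j by (intro distr_PiM_component) auto
    have m: "(\<lambda>x. x j) \<in> PP \<rightarrow>\<^sub>M P j" using j by (intro measurable_component_singleton) auto
    have m2: "(\<lambda>x. ln (f j x)) \<in> borel_measurable (P j)" by simp
    show ?thesis
      using integrable_distr_eq[OF m m2] integral_distr[OF m m2] ln_f_integrable[OF j]
      unfolding d by simp
  qed
  show "integrable PP (\<lambda>x. ln (L n x))"
    unfolding eq using * by (intro Bochner_Integration.integrable_sum) auto
  show "(\<integral>x. ln (L n x) \<partial>PP) = (\<Sum>j\<in>{1..n}. \<integral>x. ln (f j x) \<partial>P j)"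
    unfolding eq using * by (subst Bochner_Integration.integral_sum) auto
qed

text \<open>Under \<open>PP\<close> the mean of \<open>ln (L m)\<close> is the \<open>m\<close>-th
  partial sum. Its difference from the integral of \<open>l * ln l\<close> is the relative entropy
  of \<open>PP\<close> with respect to the measure with density \<open>L m\<close>. That lies
  between 0 and the chi-square bound \<open>p' / p m - 1\<close>, which tends to 0.\<close>

theorem product_density_relative_entropy:
  obtains l where "l \<in> borel_measurable QQ" "\<And>x. l x \<ge> 0" "PP = density QQ (\<lambda>x. ennreal (l x))"
    "(\<lambda>j. \<integral>x. ln (f (Suc j) x) \<partial>P (Suc j)) sums (\<integral>x. l x * ln (l x) \<partial>QQ)"
proof -
  obtain r l where r: "strict_mono r" and l: "integrable QQ l" and l_nonneg: "\<And>x. l x \<ge> 0"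
    and lim: "AE x in QQ. (\<lambda>i. L (r i) x) \<longlonglongrightarrow> l x" and PP: "PP = density QQ (\<lambda>x. ennreal (l x))"
    by (rule L_limit, rule that)
  note [measurable] = borel_measurable_integrable[OF l]
  obtain p' where p': "p \<longlonglongrightarrow> p'" using p_convergent by (auto simp: convergent_def)
  have p'_pos: "p' > 0"
    using p_pos[of 0] incseq_le[OF incseq_def[THEN iffD2] p', of 0] p_mono by force
  have l_one: "(\<integral>x. l x \<partial>QQ) = 1"
  proof -
    have "ennreal (\<integral>x. l x \<partial>QQ) = (\<integral>\<^sup>+x. l x \<partial>QQ)"
      by (intro nn_integral_eq_integral[symmetric] l) (auto simp: l_nonneg)
    also have "\<dots> = emeasure (density QQ (\<lambda>x. ennreal (l x))) (space QQ)"
      by (simp add: emeasure_density cong: nn_integral_cong_simp)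
    also have "\<dots> = 1"
      using PP.emeasure_space_1 unfolding PP by simp
    finally show ?thesis by simp
  qed
  \<comment> \<open>Fatou's lemma along \<open>r\<close>, the subsequence on which \<open>l\<close>
    is a pointwise limit, applied to \<open>nn_integral_L_sq_div\<close> with upper index
    \<open>r i\<close>.\<close>
  have sq: "integrable QQ (\<lambda>x. (l x)\<^sup>2 / L m x) \<and> (\<integral>x. (l x)\<^sup>2 / L m x \<partial>QQ) \<le> p' / p m" for m
  proof -
    have "(\<integral>\<^sup>+x. ennreal ((l x)\<^sup>2 / L m x) \<partial>QQ)
        = (\<integral>\<^sup>+x. liminf (\<lambda>i. ennreal ((L (r i) x)\<^sup>2 / L m x)) \<partial>QQ)"
    proof (rule nn_integral_cong_AE)
      show "AE x in QQ. ennreal ((l x)\<^sup>2 / L m x) = liminf (\<lambda>i. ennreal ((L (r i) x)\<^sup>2 / L m x))"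
        using lim
      proof eventually_elim
        case (elim x)
        have "(\<lambda>i. ennreal ((L (r i) x)\<^sup>2 / L m x)) \<longlonglongrightarrow> ennreal ((l x)\<^sup>2 / L m x)"
          using elim less_imp_neq[OF L_pos[of m x]] by (intro tendsto_ennrealI tendsto_intros) auto
        then show ?case by (rule lim_imp_Liminf[OF sequentially_bot, symmetric])
      qed
    qed
    also have "\<dots> \<le> liminf (\<lambda>i. \<integral>\<^sup>+x. ennreal ((L (r i) x)\<^sup>2 / L m x) \<partial>QQ)"
      by (intro nn_integral_liminf) auto
    also have "\<dots> = ennreal (p' / p m)"
    proof (rule lim_imp_Liminf[OF sequentially_bot])
      have "(\<lambda>i. ennreal (p (r i) / p m)) \<longlonglongrightarrow> ennreal (p' / p m)"
        using LIMSEQ_subseq_LIMSEQ[OF p' r] p_pos[of m] by (intro tendsto_ennrealI tendsto_intros) (auto simp: o_def)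
      moreover have "\<forall>\<^sub>F i in sequentially.
          ennreal (p (r i) / p m) = (\<integral>\<^sup>+x. ennreal ((L (r i) x)\<^sup>2 / L m x) \<partial>QQ)"
        using eventually_ge_at_top[of m]
      proof eventually_elim
        case (elim i)
        then have "m \<le> r i" using seq_suble[OF r, of i] by simp
        then show ?case by (simp add: nn_integral_L_sq_div)
      qed
      ultimately show "(\<lambda>i. \<integral>\<^sup>+x. ennreal ((L (r i) x)\<^sup>2 / L m x) \<partial>QQ) \<longlonglongrightarrow> ennreal (p' / p m)"
        by (rule Lim_transform_eventually)
    qed
    finally have le: "(\<integral>\<^sup>+x. ennreal ((l x)\<^sup>2 / L m x) \<partial>QQ) \<le> ennreal (p' / p m)" .
    have nonneg: "(l x)\<^sup>2 / L m x \<ge> 0" for x using L_pos[of m x] by simp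
    have int: "integrable QQ (\<lambda>x. (l x)\<^sup>2 / L m x)"
      using le nonneg by (intro integrableI_nonneg) (auto simp: top.not_eq_extremum intro: le_less_trans)
    have "ennreal (\<integral>x. (l x)\<^sup>2 / L m x \<partial>QQ) \<le> ennreal (p' / p m)"
      using le nn_integral_eq_integral[OF int] nonneg by simp
    then show ?thesis
      using int p'_pos p_pos[of m] by (simp add: ennreal_le_iff)
  qed
  have lnL: "integrable QQ (\<lambda>x. l x * ln (L m x))"
    "(\<integral>x. l x * ln (L m x) \<partial>QQ) = (\<Sum>j\<in>{1..m}. \<integral>x. ln (f j x) \<partial>P j)" for m
    using ln_L_integrable[of m] ln_L_integral[of m] unfolding PP
    by (simp_all add: integrable_density integral_density l_nonneg)
  text \<open>Both bounds are \<open>ln t \<le> t - 1\<close>, at \<open>t = l x / L m x\<close> and at its inverse, multiplied by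
    \<open>l x\<close> so that they also hold where \<open>l x = 0\<close>.\<close>
  have up: "l x * ln (l x) - l x * ln (L m x) \<le> (l x)\<^sup>2 / L m x - l x" for m x
  proof (cases "l x = 0")
    case False
    then have lx: "l x > 0" using l_nonneg[of x] by simp
    have "l x * (ln (l x) - ln (L m x)) \<le> l x * (l x / L m x - 1)"
      using ln_le_minus_one[of "l x / L m x"] lx L_pos[of m x]
      by (intro mult_left_mono) (auto simp: ln_div)
    then show ?thesis by (simp add: algebra_simps power2_eq_square)
  qed simp
  have low: "l x - L m x \<le> l x * ln (l x) - l x * ln (L m x)" for m x
  proof (cases "l x = 0")
    case False
    then have lx: "l x > 0" using l_nonneg[of x] by simp
    have "l x * (1 - L m x / l x) \<le> l x * (ln (l x) - ln (L m x))"
      using ln_le_minus_one[of "L m x / l x"] lx L_pos[of m x]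
      by (intro mult_left_mono) (auto simp: ln_div)
    then show ?thesis using lx by (simp add: algebra_simps)
  qed (use L_pos[of m x] in simp)
  \<comment> \<open>At \<open>m = 0\<close> the two bounds become
    \<open>l - 1 \<le> l * ln l \<le> l\<^sup>2 - l\<close>, which gives integrability.\<close>
  have L0: "L 0 x = 1" for x by (simp add: L_def)
  have "integrable QQ (\<lambda>x. (l x)\<^sup>2 + l x + 1)"
    using sq[of 0] l by (auto simp: L0)
  then have lnl: "integrable QQ (\<lambda>x. l x * ln (l x))"
  proof (rule Bochner_Integration.integrable_bound)
    show "AE x in QQ. norm (l x * ln (l x)) \<le> norm ((l x)\<^sup>2 + l x + 1)"
    proof (rule AE_I2)
      fix x
      show "norm (l x * ln (l x)) \<le> norm ((l x)\<^sup>2 + l x + 1)"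
        using up[of x 0] low[of x 0] l_nonneg[of x] zero_le_power2[of "l x"]
        unfolding L0 real_norm_def ln_one by linarith
    qed
  qed auto
  \<comment> \<open>The left side of \<open>low\<close> integrates to zero, since \<open>l\<close>
    and \<open>L m\<close> both have mass one.\<close>
  have lower: "(\<Sum>j\<in>{1..m}. \<integral>x. ln (f j x) \<partial>P j) \<le> (\<integral>x. l x * ln (l x) \<partial>QQ)" for m
  proof -
    have "(\<integral>x. l x - L m x \<partial>QQ) \<le> (\<integral>x. l x * ln (l x) - l x * ln (L m x) \<partial>QQ)"
      by (intro integral_mono Bochner_Integration.integrable_diff lnl lnL l L_integrable low)
    then show ?thesis
      by (simp add: l L_integrable lnl lnL l_one L_integral)
  qed
  have upper: "(\<integral>x. l x * ln (l x) \<partial>QQ) - (p' / p m - 1) \<le> (\<Sum>j\<in>{1..m}. \<integral>x. ln (f j x) \<partial>P j)" for m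
  proof -
    have "(\<integral>x. l x * ln (l x) - l x * ln (L m x) \<partial>QQ) \<le> (\<integral>x. (l x)\<^sup>2 / L m x - l x \<partial>QQ)"
      using sq[of m] by (intro integral_mono Bochner_Integration.integrable_diff lnl lnL l up) auto
    then show ?thesis
      using sq[of m] by (simp add: l lnl lnL l_one)
  qed
  have "(\<lambda>m. \<Sum>j\<in>{1..m}. \<integral>x. ln (f j x) \<partial>P j) \<longlonglongrightarrow> (\<integral>x. l x * ln (l x) \<partial>QQ)"
  proof (rule tendsto_sandwich[OF always_eventually always_eventually _ tendsto_const])
    show "(\<lambda>m. (\<integral>x. l x * ln (l x) \<partial>QQ) - (p' / p m - 1)) \<longlonglongrightarrow> (\<integral>x. l x * ln (l x) \<partial>QQ)"
      using p'_pos by (auto intro!: tendsto_eq_intros p')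
  qed (use upper lower in auto)
  then have "(\<lambda>j. \<integral>x. ln (f (Suc j) x) \<partial>P (Suc j)) sums (\<integral>x. l x * ln (l x) \<partial>QQ)"
    unfolding sums_def by (simp add: sum.atLeast1_atMost_eq One_nat_def)
  with that[OF _ l_nonneg PP] show thesis by simp
qed

end

section \<open>Pairing two sequences\<close>

context prob_space
begin

text \<open>With all variables indexed by the disjoint sum, each claim is independence of disjoint
  blocks: the blocks \<open>{Inl i, Inr i}\<close>, the two sides, or two singletons.\<close>

lemma
  fixes X :: "'i + 'i \<Rightarrow> 'a \<Rightarrow> 'b"
  assumes ind: "indep_vars N X (I <+> I)"
  shows indep_vars_zip:
      "indep_vars (\<lambda>i. N (Inl i) \<Otimes>\<^sub>M N (Inr i)) (\<lambda>i \<omega>. (X (Inl i) \<omega>, X (Inr i) \<omega>)) I"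
    and indep_var_unzip:
      "indep_var (PiM I (\<lambda>i. N (Inl i))) (\<lambda>\<omega>. \<lambda>i\<in>I. X (Inl i) \<omega>)
                 (PiM I (\<lambda>i. N (Inr i))) (\<lambda>\<omega>. \<lambda>i\<in>I. X (Inr i) \<omega>)"
    and indep_var_zip: "i \<in> I \<Longrightarrow> indep_var (N (Inl i)) (X (Inl i)) (N (Inr i)) (X (Inr i))"
proof -
  have "indep_vars (\<lambda>i. PiM {Inl i, Inr i} N) (\<lambda>i \<omega>. restrict (\<lambda>k. X k \<omega>) {Inl i, Inr i}) I"
    by (intro indep_vars_restrict[OF ind]) (auto simp: disjoint_family_on_def)
  then have "indep_vars (\<lambda>i. N (Inl i) \<Otimes>\<^sub>M N (Inr i))
      (\<lambda>i \<omega>. (\<lambda>x. (x (Inl i), x (Inr i))) (restrict (\<lambda>k. X k \<omega>) {Inl i, Inr i})) I"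
    by (rule indep_vars_compose2) (auto intro!: measurable_Pair measurable_component_singleton)
  then show "indep_vars (\<lambda>i. N (Inl i) \<Otimes>\<^sub>M N (Inr i)) (\<lambda>i \<omega>. (X (Inl i) \<omega>, X (Inr i) \<omega>)) I"
    by simp
  have "indep_var (PiM (Inl ` I) N) (\<lambda>\<omega>. restrict (\<lambda>k. X k \<omega>) (Inl ` I))
                  (PiM (Inr ` I) N) (\<lambda>\<omega>. restrict (\<lambda>k. X k \<omega>) (Inr ` I))"
    by (intro indep_var_restrict[OF ind]) auto
  then have "indep_var (PiM I (\<lambda>i. N (Inl i))) ((\<lambda>x. \<lambda>i\<in>I. x (Inl i)) \<circ> (\<lambda>\<omega>. restrict (\<lambda>k. X k \<omega>) (Inl ` I)))
                  (PiM I (\<lambda>i. N (Inr i))) ((\<lambda>x. \<lambda>i\<in>I. x (Inr i)) \<circ> (\<lambda>\<omega>. restrict (\<lambda>k. X k \<omega>) (Inr ` I)))"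
    by (rule indep_var_compose) (auto intro!: measurable_restrict measurable_component_singleton)
  moreover have "(\<lambda>x. \<lambda>i\<in>I. x (Inl i)) \<circ> (\<lambda>\<omega>. restrict (\<lambda>k. X k \<omega>) (Inl ` I)) = (\<lambda>\<omega>. \<lambda>i\<in>I. X (Inl i) \<omega>)"
    "(\<lambda>x. \<lambda>i\<in>I. x (Inr i)) \<circ> (\<lambda>\<omega>. restrict (\<lambda>k. X k \<omega>) (Inr ` I)) = (\<lambda>\<omega>. \<lambda>i\<in>I. X (Inr i) \<omega>)"
    by (auto simp: fun_eq_iff)
  ultimately show "indep_var (PiM I (\<lambda>i. N (Inl i))) (\<lambda>\<omega>. \<lambda>i\<in>I. X (Inl i) \<omega>)
                 (PiM I (\<lambda>i. N (Inr i))) (\<lambda>\<omega>. \<lambda>i\<in>I. X (Inr i) \<omega>)"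
    by simp
  assume i: "i \<in> I"
  have "indep_var (PiM {Inl i} N) (\<lambda>\<omega>. restrict (\<lambda>k. X k \<omega>) {Inl i})
                  (PiM {Inr i} N) (\<lambda>\<omega>. restrict (\<lambda>k. X k \<omega>) {Inr i})"
    using i by (intro indep_var_restrict[OF ind]) auto
  then have "indep_var (N (Inl i)) ((\<lambda>x. x (Inl i)) \<circ> (\<lambda>\<omega>. restrict (\<lambda>k. X k \<omega>) {Inl i}))
                  (N (Inr i)) ((\<lambda>x. x (Inr i)) \<circ> (\<lambda>\<omega>. restrict (\<lambda>k. X k \<omega>) {Inr i}))"
    by (rule indep_var_compose) auto
  then show "indep_var (N (Inl i)) (X (Inl i)) (N (Inr i)) (X (Inr i))"
    by (simp add: comp_def)
qed

end

text \<open>Independence across indices lives on sequences of pairs, mutual information on pairs of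
  sequences; \<open>unzip\<close> and \<open>zip_fun\<close> pass between them. The restrictions
  keep the values in the extensional spaces underlying \<open>PiM\<close>.\<close>

definition unzip :: "'i set \<Rightarrow> ('i \<Rightarrow> 'a \<times> 'b) \<Rightarrow> ('i \<Rightarrow> 'a) \<times> ('i \<Rightarrow> 'b)" where
  "unzip I x = (\<lambda>i\<in>I. fst (x i), \<lambda>i\<in>I. snd (x i))"

definition zip_fun :: "'i set \<Rightarrow> ('i \<Rightarrow> 'a) \<times> ('i \<Rightarrow> 'b) \<Rightarrow> 'i \<Rightarrow> 'a \<times> 'b" where
  "zip_fun I u = (\<lambda>i\<in>I. (fst u i, snd u i))"

lemma measurable_unzip: "unzip I \<in> PiM I (\<lambda>i. A i \<Otimes>\<^sub>M B i) \<rightarrow>\<^sub>M PiM I A \<Otimes>\<^sub>M PiM I B"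
proof -
  have "(\<lambda>x. x i) \<in> PiM I (\<lambda>i. A i \<Otimes>\<^sub>M B i) \<rightarrow>\<^sub>M A i \<Otimes>\<^sub>M B i" if "i \<in> I" for i
    using that by (rule measurable_component_singleton)
  from measurable_compose[OF this measurable_fst] measurable_compose[OF this measurable_snd]
  show ?thesis
    unfolding unzip_def by (intro measurable_Pair measurable_restrict) auto
qed

lemma measurable_zip_fun: "zip_fun I \<in> PiM I A \<Otimes>\<^sub>M PiM I B \<rightarrow>\<^sub>M PiM I (\<lambda>i. A i \<Otimes>\<^sub>M B i)"
  unfolding zip_fun_def
  by (intro measurable_restrict measurable_Pair
        measurable_compose[OF measurable_fst measurable_component_singleton]
        measurable_compose[OF measurable_snd measurable_component_singleton])

lemma zip_fun_unzip: "x \<in> extensional I \<Longrightarrow> zip_fun I (unzip I x) = x"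
  by (auto simp: zip_fun_def unzip_def fun_eq_iff extensional_def)

lemma pair_PiM_eq_distr_unzip:
  fixes A B :: "'i \<Rightarrow> 'b measure"
  assumes A: "\<And>i. i \<in> I \<Longrightarrow> prob_space (A i)" and B: "\<And>i. i \<in> I \<Longrightarrow> prob_space (B i)"
    and I: "I \<noteq> {}"
  shows "PiM I A \<Otimes>\<^sub>M PiM I B
    = distr (PiM I (\<lambda>i. A i \<Otimes>\<^sub>M B i)) (PiM I A \<Otimes>\<^sub>M PiM I B) (unzip I)"
proof -
  text \<open>On the product over \<open>I <+> I\<close> all coordinates are independent, and they can be regrouped either by
    side or by index.\<close>
  define N where "N = case_sum A B"
  define R where "R = PiM (I <+> I) N"
  have pN: "prob_space (N k)" if "k \<in> I <+> I" for k
    using A B that by (auto simp: N_def)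
  interpret R: prob_space R unfolding R_def by (intro prob_space_PiM pN)
  have ind: "R.indep_vars N (\<lambda>k x. x k) (I <+> I)"
    unfolding R_def using I by (intro indep_vars_PiM_component pN) auto
  have rv [measurable]: "(\<lambda>x. x (Inl i)) \<in> R \<rightarrow>\<^sub>M A i" "(\<lambda>x. x (Inr i)) \<in> R \<rightarrow>\<^sub>M B i" if "i \<in> I" for i
    using that measurable_component_singleton[of "Inl i" "I <+> I" N]
      measurable_component_singleton[of "Inr i" "I <+> I" N] by (auto simp: R_def N_def)
  have comp: "distr R (A i) (\<lambda>x. x (Inl i)) = A i" "distr R (B i) (\<lambda>x. x (Inr i)) = B i" if "i \<in> I" for i
    using that distr_PiM_component[of "I <+> I" N "Inl i"] distr_PiM_component[of "I <+> I" N "Inr i"] pN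
    by (auto simp: R_def N_def)
  have W: "R.indep_vars (\<lambda>i. A i \<Otimes>\<^sub>M B i) (\<lambda>i x. (x (Inl i), x (Inr i))) I"
    using R.indep_vars_zip[OF ind] by (simp add: N_def)
  have "distr R (A i \<Otimes>\<^sub>M B i) (\<lambda>x. (x (Inl i), x (Inr i))) = A i \<Otimes>\<^sub>M B i" if "i \<in> I" for i
    using R.indep_var_zip[OF ind that] comp[OF that]
    by (simp add: R.indep_var_distribution_eq N_def)
  then have W_eq: "distr R (PiM I (\<lambda>i. A i \<Otimes>\<^sub>M B i)) (\<lambda>x. \<lambda>i\<in>I. (x (Inl i), x (Inr i)))
      = PiM I (\<lambda>i. A i \<Otimes>\<^sub>M B i)"
    using W I rv by (subst (asm) R.indep_vars_iff_distr_eq_PiM') (auto intro!: PiM_cong)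
  have "distr R (PiM I A) (\<lambda>x. \<lambda>i\<in>I. x (Inl i)) = PiM I A"
    using distr_PiM_reindex[of "I <+> I" N Inl I, OF pN] by (auto simp: R_def N_def)
  moreover have "distr R (PiM I B) (\<lambda>x. \<lambda>i\<in>I. x (Inr i)) = PiM I B"
    using distr_PiM_reindex[of "I <+> I" N Inr I, OF pN] by (auto simp: R_def N_def)
  ultimately have "PiM I A \<Otimes>\<^sub>M PiM I B
      = distr R (PiM I A \<Otimes>\<^sub>M PiM I B) (\<lambda>x. (\<lambda>i\<in>I. x (Inl i), \<lambda>i\<in>I. x (Inr i)))"
    using R.indep_var_unzip[OF ind] by (simp add: R.indep_var_distribution_eq N_def)
  also have "\<dots> = distr R (PiM I A \<Otimes>\<^sub>M PiM I B) (unzip I \<circ> (\<lambda>x. \<lambda>i\<in>I. (x (Inl i), x (Inr i))))"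
    by (intro distr_cong) (auto simp: unzip_def fun_eq_iff)
  also have "\<dots> = distr (distr R (PiM I (\<lambda>i. A i \<Otimes>\<^sub>M B i)) (\<lambda>x. \<lambda>i\<in>I. (x (Inl i), x (Inr i))))
      (PiM I A \<Otimes>\<^sub>M PiM I B) (unzip I)"
    by (rule distr_distr[symmetric, OF measurable_unzip]) (intro measurable_restrict measurable_Pair rv)
  finally show ?thesis unfolding W_eq .
qed

section \<open>The scalar Gaussian channel\<close>

text \<open>Turns the squared noise density in the second moment into a Gaussian with half the
  variance, so that the convolution formula applies to it.\<close>

lemma normal_density_sq:
  assumes "s > 0"
  shows "(normal_density 0 s u)\<^sup>2 = normal_density 0 (s / sqrt 2) u / (2 * s * sqrt pi)"
  using assms
  by (simp add: normal_density_def power_mult_distrib power_divide exp_double[symmetric]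
      real_sqrt_mult real_sqrt_divide field_simps) (simp add: power2_eq_square)

text \<open>Inverse variances subtract:
  \<open>1 / u\<^sup>2 = 1 / w\<^sup>2 - 1 / v\<^sup>2\<close>, which is positive because
  \<open>w < v\<close>. The prefactor collects the normalising constants.\<close>

lemma normal_density_divide:
  assumes "0 < w" "w < v"
  defines "u \<equiv> w * v / sqrt (v\<^sup>2 - w\<^sup>2)"
  shows "normal_density 0 w y / normal_density 0 v y = v\<^sup>2 / sqrt (v\<^sup>2 - w\<^sup>2) * sqrt (2 * pi) * normal_density 0 u y"
proof -
  define d where "d = v\<^sup>2 - w\<^sup>2"
  have "d > 0" using assms by (simp add: d_def power_strict_mono)
  have u2: "u\<^sup>2 = w\<^sup>2 * v\<^sup>2 / d" using \<open>d > 0\<close> by (simp add: u_def d_def power_divide power_mult_distrib)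
  have e: "exp (- (y\<^sup>2 / (2 * w\<^sup>2))) / exp (- (y\<^sup>2 / (2 * v\<^sup>2))) = exp (- (y\<^sup>2 / (2 * u\<^sup>2)))"
  proof -
    have "- (y\<^sup>2 / (2 * w\<^sup>2)) - - (y\<^sup>2 / (2 * v\<^sup>2)) = - (y\<^sup>2 / (2 * u\<^sup>2))"
      using assms(1,2) \<open>d > 0\<close> unfolding u2 by (simp add: field_simps d_def)
    then show ?thesis by (simp add: exp_diff[symmetric])
  qed
  have "normal_density 0 w y / normal_density 0 v y
     = v / w * (exp (- (y\<^sup>2 / (2 * w\<^sup>2))) / exp (- (y\<^sup>2 / (2 * v\<^sup>2))))"
    using assms(1,2) by (simp add: normal_density_def real_sqrt_mult)
  also have "\<dots> = v / w * sqrt (2 * pi * u\<^sup>2) * normal_density 0 u y"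
  proof -
    have "u\<^sup>2 > 0" using \<open>d > 0\<close> assms(1,2) unfolding u2 by simp
    then show ?thesis unfolding e normal_density_def by simp
  qed
  also have "v / w * sqrt (2 * pi * u\<^sup>2) = v\<^sup>2 / sqrt d * sqrt (2 * pi)"
    using assms(1,2) \<open>d > 0\<close> unfolding u2
    by (simp add: real_sqrt_mult real_sqrt_divide field_simps power2_eq_square)
  finally show ?thesis by (simp add: d_def)
qed

text \<open>The substitution of \<open>\<kappa> * x\<close> for the variable reduces this to the
  unscaled convolution of centred Gaussians; the Jacobian is absorbed by the rescaled prior
  density.\<close>

lemma conv_normal_density_scaled:
  assumes "\<kappa> > 0" "\<tau> > 0" "s > 0"
  shows "(\<integral>\<^sup>+x. ennreal (normal_density 0 \<tau> x * normal_density 0 s (y - \<kappa> * x)) \<partial>lborel)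
    = ennreal (normal_density 0 (sqrt (\<kappa>\<^sup>2 * \<tau>\<^sup>2 + s\<^sup>2)) y)"
proof -
  have scale: "normal_density 0 \<tau> x = \<kappa> * normal_density 0 (\<kappa> * \<tau>) (\<kappa> * x)" for x
    using assms by (simp add: normal_density_def real_sqrt_mult power_mult_distrib field_simps)
  have "ennreal (normal_density 0 (sqrt (s\<^sup>2 + (\<kappa> * \<tau>)\<^sup>2)) y)
    = (\<integral>\<^sup>+x. ennreal (normal_density 0 s (y - x) * normal_density 0 (\<kappa> * \<tau>) x) \<partial>lborel)"
    using fun_cong[OF conv_normal_density_zero_mean[of s "\<kappa> * \<tau>"], of y] assms by simp
  also have "\<dots> = \<kappa> * (\<integral>\<^sup>+x. ennreal (normal_density 0 s (y - \<kappa> * x) * normal_density 0 (\<kappa> * \<tau>) (\<kappa> * x)) \<partial>lborel)"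
    using assms by (subst nn_integral_real_affine[where c = \<kappa> and t = 0]) auto
  also have "\<dots> = (\<integral>\<^sup>+x. ennreal (normal_density 0 \<tau> x * normal_density 0 s (y - \<kappa> * x)) \<partial>lborel)"
    using assms
    by (subst nn_integral_cmult[symmetric]) (auto simp: scale ennreal_mult'[symmetric] mult_ac)
  finally show ?thesis by (simp add: power_mult_distrib add.commute)
qed

text \<open>The conditional density of the output \<open>y\<close> given the input \<open>x\<close>,
  over the marginal density of the output; its logarithm is the information density of the
  channel.\<close>

definition channel_ratio :: "real \<Rightarrow> real \<Rightarrow> real \<Rightarrow> real \<times> real \<Rightarrow> real" where
  "channel_ratio \<kappa> \<tau> s = (\<lambda>(x, y).
     normal_density 0 s (y - \<kappa> * x) / normal_density 0 (sqrt (\<kappa>\<^sup>2 * \<tau>\<^sup>2 + s\<^sup>2)) y)"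

abbreviation gauss :: "real \<Rightarrow> real measure" where
  "gauss \<tau> \<equiv> density lborel (normal_density 0 \<tau>)"

locale gauss_channel =
  fixes \<kappa> \<tau> s :: real
  assumes \<kappa>: "\<kappa> > 0" and \<tau>: "\<tau> > 0" and s: "s > 0"
begin

text \<open>The standard deviation of the output.\<close>

definition v :: real where "v = sqrt (\<kappa>\<^sup>2 * \<tau>\<^sup>2 + s\<^sup>2)"

lemma v_sq: "v\<^sup>2 = \<kappa>\<^sup>2 * \<tau>\<^sup>2 + s\<^sup>2"
  by (simp add: v_def)

lemma v_pos: "v > 0"
  using \<kappa> \<tau> s by (simp add: v_def add_pos_pos)

lemma channel_ratio_eq: "channel_ratio \<kappa> \<tau> s (x, y) = normal_density 0 s (y - \<kappa> * x) / normal_density 0 v y"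
  by (simp add: channel_ratio_def v_def)

lemma channel_ratio_pos: "channel_ratio \<kappa> \<tau> s z > 0"
  using normal_density_pos s v_pos by (cases z) (simp add: channel_ratio_eq)

lemma channel_ratio_measurable [measurable]: "channel_ratio \<kappa> \<tau> s \<in> borel_measurable (borel \<Otimes>\<^sub>M borel)"
  unfolding channel_ratio_def by measurable

lemma prob_space_gauss: "t > 0 \<Longrightarrow> prob_space (gauss t)"
  using prob_space_normal_density by simp

lemma marginal_product:
  "gauss \<tau> \<Otimes>\<^sub>M gauss v
    = density (lborel \<Otimes>\<^sub>M lborel) (\<lambda>(x, y). ennreal (normal_density 0 \<tau> x) * ennreal (normal_density 0 v y))"
  by (intro pair_measure_density)
     (auto intro!: lborel.sigma_finite_measure_axioms prob_space_imp_sigma_finite prob_space_gauss v_pos)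

lemma density_channel_ratio:
  "density (gauss \<tau> \<Otimes>\<^sub>M gauss v) (channel_ratio \<kappa> \<tau> s)
    = density (lborel \<Otimes>\<^sub>M lborel) (\<lambda>(x, y). ennreal (normal_density 0 \<tau> x * normal_density 0 s (y - \<kappa> * x)))"
  unfolding marginal_product
  by (subst density_density_eq)
     (auto intro!: density_cong simp: channel_ratio_eq ennreal_mult'[symmetric] normal_density_pos[OF v_pos, THEN less_imp_neq, symmetric])

text \<open>Squaring halves the noise variance, so integrating out the input leaves a Gaussian of
  variance \<open>w\<^sup>2 = \<kappa>\<^sup>2 * \<tau>\<^sup>2 + s\<^sup>2 / 2\<close>. Since
  \<open>v\<^sup>2 - w\<^sup>2 = s\<^sup>2 / 2 > 0\<close> for all parameters, dividing by the
  output density leaves a multiple of another Gaussian, whose mass is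
  \<open>v\<^sup>2 / s\<^sup>2\<close>.\<close>

lemma channel_ratio_second_moment:
  "(\<integral>\<^sup>+z. (channel_ratio \<kappa> \<tau> s z)\<^sup>2 \<partial>(gauss \<tau> \<Otimes>\<^sub>M gauss v)) = ennreal (1 + \<kappa>\<^sup>2 * \<tau>\<^sup>2 / s\<^sup>2)"
proof -
  define w where "w = sqrt (\<kappa>\<^sup>2 * \<tau>\<^sup>2 + (s / sqrt 2)\<^sup>2)"
  have w_sq: "w\<^sup>2 = \<kappa>\<^sup>2 * \<tau>\<^sup>2 + s\<^sup>2 / 2" by (simp add: w_def power_divide)
  have w: "0 < w" "w < v"
    using \<kappa> \<tau> s by (auto simp: w_def v_def power_divide add_pos_pos)
  define u where "u = w * v / sqrt (v\<^sup>2 - w\<^sup>2)"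
  have "v\<^sup>2 - w\<^sup>2 = s\<^sup>2 / 2" by (simp add: v_sq w_sq)
  then have d: "sqrt (v\<^sup>2 - w\<^sup>2) = s / sqrt 2" using s by (simp only: real_sqrt_divide real_sqrt_abs abs_of_pos)
  have u: "u > 0" using w v_pos s unfolding u_def d by simp
  have pos: "normal_density 0 v y > 0" for y by (rule normal_density_pos[OF v_pos])
  have "(\<integral>\<^sup>+z. (channel_ratio \<kappa> \<tau> s z)\<^sup>2 \<partial>(gauss \<tau> \<Otimes>\<^sub>M gauss v))
    = (\<integral>\<^sup>+z. (case z of (x, y) \<Rightarrow> ennreal (1 / (2 * s * sqrt pi) / normal_density 0 v y)
         * ennreal (normal_density 0 \<tau> x * normal_density 0 (s / sqrt 2) (y - \<kappa> * x))) \<partial>(lborel \<Otimes>\<^sub>M lborel))"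
    unfolding marginal_product
    by (subst nn_integral_density)
       (auto intro!: nn_integral_cong simp: channel_ratio_eq ennreal_mult'[symmetric] power_divide
         normal_density_sq[OF s, unfolded power2_eq_square] field_simps power2_eq_square less_imp_neq[OF pos, symmetric] s[THEN less_imp_le])
  also have "\<dots> = (\<integral>\<^sup>+y. \<integral>\<^sup>+x. ennreal (1 / (2 * s * sqrt pi) / normal_density 0 v y)
         * ennreal (normal_density 0 \<tau> x * normal_density 0 (s / sqrt 2) (y - \<kappa> * x)) \<partial>lborel \<partial>lborel)"
    by (subst lborel_pair.nn_integral_snd[symmetric]) auto
  also have "\<dots> = (\<integral>\<^sup>+y. ennreal (1 / (2 * s * sqrt pi) / normal_density 0 v y) * ennreal (normal_density 0 w y) \<partial>lborel)"
    using conv_normal_density_scaled[OF \<kappa> \<tau>, of "s / sqrt 2"] s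
    by (intro nn_integral_cong, subst nn_integral_cmult) (auto simp: w_def)
  also have "\<dots> = (\<integral>\<^sup>+y. ennreal (v\<^sup>2 / s\<^sup>2) * ennreal (normal_density 0 u y) \<partial>lborel)"
  proof (rule nn_integral_cong)
    fix y :: real
    have "1 / (2 * s * sqrt pi) / normal_density 0 v y * normal_density 0 w y
       = 1 / (2 * s * sqrt pi) * (normal_density 0 w y / normal_density 0 v y)" by simp
    also have "\<dots> = 1 / (2 * s * sqrt pi) * (v\<^sup>2 / (s / sqrt 2) * sqrt (2 * pi)) * normal_density 0 u y"
      unfolding normal_density_divide[OF w] u_def d by simp
    also have "1 / (2 * s * sqrt pi) * (v\<^sup>2 / (s / sqrt 2) * sqrt (2 * pi)) = v\<^sup>2 / s\<^sup>2"
      using s by (simp add: real_sqrt_mult field_simps power2_eq_square)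
    finally show "ennreal (1 / (2 * s * sqrt pi) / normal_density 0 v y) * ennreal (normal_density 0 w y)
        = ennreal (v\<^sup>2 / s\<^sup>2) * ennreal (normal_density 0 u y)"
      using s by (simp add: ennreal_mult'[symmetric] less_imp_le[OF pos])
  qed
  also have "\<dots> = ennreal (v\<^sup>2 / s\<^sup>2)"
    using u by (subst nn_integral_cmult) (auto simp: nn_integral_eq_integral)
  also have "v\<^sup>2 / s\<^sup>2 = 1 + \<kappa>\<^sup>2 * \<tau>\<^sup>2 / s\<^sup>2"
    using s by (simp add: v_sq field_simps)
  finally show ?thesis .
qed

end

section \<open>The channel realised by random variables\<close>

locale gauss_channel_model = gauss_channel + prob_space M for M :: "'a measure" +
  fixes X E :: "'a \<Rightarrow> real"
  assumes indep: "indep_var borel X borel E"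
    and X: "distributed M lborel X (normal_density 0 \<tau>)"
    and E: "distributed M lborel E (normal_density 0 s)"
begin

lemma X_measurable [measurable]: "X \<in> borel_measurable M"
  and E_measurable [measurable]: "E \<in> borel_measurable M"
  using distributed_measurable[OF X] distributed_measurable[OF E] by simp_all

lemma output_distributed: "distributed M lborel (\<lambda>\<omega>. \<kappa> * X \<omega> + E \<omega>) (normal_density 0 v)"
proof -
  have "distributed M lborel (\<lambda>\<omega>. 0 + \<kappa> * X \<omega>) (normal_density (0 + \<kappa> * 0) (\<bar>\<kappa>\<bar> * \<tau>))"
    using \<kappa> \<tau> by (intro normal_density_affine X) auto
  moreover have "indep_var borel ((*) \<kappa> \<circ> X) borel (id \<circ> E)"
    by (rule indep_var_compose[OF indep]) auto
  ultimately have "distributed M lborel (\<lambda>\<omega>. \<kappa> * X \<omega> + E \<omega>)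
      (normal_density (0 + 0) (sqrt ((\<kappa> * \<tau>)\<^sup>2 + s\<^sup>2)))"
    using \<kappa> \<tau> s E by (intro add_indep_normal) (auto simp: comp_def)
  then show ?thesis by (simp add: v_def power_mult_distrib)
qed

text \<open>The law of the pair is the image of the law of \<open>(X, E)\<close> under the shear
  \<open>(x, e) \<mapsto> (x, \<kappa> * x + e)\<close>. For fixed \<open>x\<close> this is a
  translation, so Lebesgue measure is preserved and no Jacobian appears.\<close>

lemma distr_channel:
  "distr M (borel \<Otimes>\<^sub>M borel) (\<lambda>\<omega>. (X \<omega>, \<kappa> * X \<omega> + E \<omega>))
    = density (gauss \<tau> \<Otimes>\<^sub>M gauss v) (channel_ratio \<kappa> \<tau> s)" (is "?L = _")
proof -
  have "distributed M (lborel \<Otimes>\<^sub>M lborel) (\<lambda>\<omega>. (X \<omega>, E \<omega>))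
      (\<lambda>(x, e). ennreal (normal_density 0 \<tau> x) * ennreal (normal_density 0 s e))"
    using indep X E
    by (intro distributed_joint_indep lborel.sigma_finite_measure_axioms) (auto simp: indep_var_eq)
  then have d: "distr M (lborel \<Otimes>\<^sub>M lborel) (\<lambda>\<omega>. (X \<omega>, E \<omega>))
    = density (lborel \<Otimes>\<^sub>M lborel) (\<lambda>(x, e). ennreal (normal_density 0 \<tau> x) * ennreal (normal_density 0 s e))"
    by (rule distributed_distr_eq_density)
  show ?thesis unfolding density_channel_ratio
  proof (rule measure_eqI)
    fix A assume "A \<in> sets ?L"
    then have A [measurable]: "A \<in> sets (borel \<Otimes>\<^sub>M borel)" by simp
    then have A' [measurable]: "A \<in> sets (lborel \<Otimes>\<^sub>M lborel)"
      by (simp cong: sets_pair_measure_cong)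
    have "emeasure ?L A = (\<integral>\<^sup>+\<omega>. indicator A (X \<omega>, \<kappa> * X \<omega> + E \<omega>) \<partial>M)"
      by (subst nn_integral_indicator[symmetric], simp, subst nn_integral_distr) auto
    also have "\<dots> = (\<integral>\<^sup>+z. (case z of (x, e) \<Rightarrow> indicator A (x, \<kappa> * x + e)) \<partial>distr M (lborel \<Otimes>\<^sub>M lborel) (\<lambda>\<omega>. (X \<omega>, E \<omega>)))"
      by (subst nn_integral_distr) auto
    also have "\<dots> = (\<integral>\<^sup>+x. \<integral>\<^sup>+e. ennreal (normal_density 0 \<tau> x * normal_density 0 s e) * indicator A (x, \<kappa> * x + e) \<partial>lborel \<partial>lborel)"
      unfolding d
      by (subst nn_integral_density, simp, simp, subst lborel.nn_integral_fst[symmetric])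
         (auto simp: ennreal_mult')
    also have "\<dots> = (\<integral>\<^sup>+x. \<integral>\<^sup>+y. ennreal (normal_density 0 \<tau> x * normal_density 0 s (y - \<kappa> * x)) * indicator A (x, y) \<partial>lborel \<partial>lborel)"
    proof (rule nn_integral_cong)
      fix x :: real
      show "(\<integral>\<^sup>+e. ennreal (normal_density 0 \<tau> x * normal_density 0 s e) * indicator A (x, \<kappa> * x + e) \<partial>lborel)
        = (\<integral>\<^sup>+y. ennreal (normal_density 0 \<tau> x * normal_density 0 s (y - \<kappa> * x)) * indicator A (x, y) \<partial>lborel)"
        by (subst nn_integral_real_affine[where c = 1 and t = "- \<kappa> * x"]) auto
    qed
    also have "\<dots> = emeasure (density (lborel \<Otimes>\<^sub>M lborel) (\<lambda>(x, y). ennreal (normal_density 0 \<tau> x * normal_density 0 s (y - \<kappa> * x)))) A"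
      by (subst emeasure_density, simp, simp, subst lborel.nn_integral_fst[symmetric]) auto
    finally show "emeasure ?L A = emeasure (density (lborel \<Otimes>\<^sub>M lborel)
        (\<lambda>(x, y). ennreal (normal_density 0 \<tau> x * normal_density 0 s (y - \<kappa> * x)))) A" .
  qed (simp cong: sets_pair_measure_cong)
qed

text \<open>Along the realised pair the log ratio is a constant plus two quadratic terms in the
  noise and the output. Each is normalised by twice its own variance, so their means are -1/2 and
  1/2 and cancel; only the constant \<open>ln (v\<^sup>2 / s\<^sup>2) / 2\<close> remains.\<close>

lemma channel_information:
  "(\<integral>z. ln (channel_ratio \<kappa> \<tau> s z) \<partial>density (gauss \<tau> \<Otimes>\<^sub>M gauss v) (channel_ratio \<kappa> \<tau> s))
    = ln (1 + \<kappa>\<^sup>2 * \<tau>\<^sup>2 / s\<^sup>2) / 2"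
proof -
  have moment: "integrable M (\<lambda>\<omega>. (Z \<omega>)\<^sup>2) \<and> expectation (\<lambda>\<omega>. (Z \<omega>)\<^sup>2) = t\<^sup>2"
    if "distributed M lborel Z (normal_density 0 t)" "t > 0" for Z t
  proof -
    have "integrable lborel (\<lambda>x. normal_density 0 t x * x\<^sup>2)"
      using integrable_normal_moment[of t 0 2] that by simp
    then have "integrable M (\<lambda>\<omega>. (Z \<omega>)\<^sup>2)"
      using distributed_integrable[OF that(1), of "\<lambda>x. x\<^sup>2"] by simp
    moreover have "expectation (\<lambda>\<omega>. (Z \<omega>)\<^sup>2) = t\<^sup>2"
      using normal_distributed_variance[OF that(2,1)] normal_distributed_expectation[OF that(2,1)] by simp
    ultimately show ?thesis by simp
  qed
  note mE = moment[OF E s] and mY = moment[OF output_distributed v_pos]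
  have ln_nd: "ln (normal_density 0 t y) = - ln (2 * pi * t\<^sup>2) / 2 - y\<^sup>2 / (2 * t\<^sup>2)" if "t > 0" for t y
    using that by (simp add: normal_density_def ln_mult ln_div ln_sqrt field_simps)
  have "(\<integral>z. ln (channel_ratio \<kappa> \<tau> s z) \<partial>density (gauss \<tau> \<Otimes>\<^sub>M gauss v) (channel_ratio \<kappa> \<tau> s))
    = expectation (\<lambda>\<omega>. ln (channel_ratio \<kappa> \<tau> s (X \<omega>, \<kappa> * X \<omega> + E \<omega>)))"
    unfolding distr_channel[symmetric] by (rule integral_distr) auto
  also have "\<dots> = expectation (\<lambda>\<omega>. (ln (v\<^sup>2 / s\<^sup>2) / 2 - (E \<omega>)\<^sup>2 / (2 * s\<^sup>2)) + (\<kappa> * X \<omega> + E \<omega>)\<^sup>2 / (2 * v\<^sup>2))"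
  proof (rule Bochner_Integration.integral_cong[OF refl])
    fix \<omega>
    have "ln (2 * pi * v\<^sup>2) - ln (2 * pi * s\<^sup>2) = ln (v\<^sup>2 / s\<^sup>2)"
      using v_pos s by (simp add: ln_mult ln_div)
    moreover have "ln (channel_ratio \<kappa> \<tau> s (X \<omega>, \<kappa> * X \<omega> + E \<omega>))
      = ln (normal_density 0 s (E \<omega>)) - ln (normal_density 0 v (\<kappa> * X \<omega> + E \<omega>))"
      unfolding channel_ratio_eq using normal_density_pos[OF s] normal_density_pos[OF v_pos]
      by (subst ln_div) (auto simp: less_imp_neq[symmetric])
    ultimately show "ln (channel_ratio \<kappa> \<tau> s (X \<omega>, \<kappa> * X \<omega> + E \<omega>))
      = (ln (v\<^sup>2 / s\<^sup>2) / 2 - (E \<omega>)\<^sup>2 / (2 * s\<^sup>2)) + (\<kappa> * X \<omega> + E \<omega>)\<^sup>2 / (2 * v\<^sup>2)"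
      unfolding ln_nd[OF s] ln_nd[OF v_pos] by simp
  qed
  also have "\<dots> = ln (v\<^sup>2 / s\<^sup>2) / 2"
    using mE mY s v_pos by (simp add: prob_space)
  also have "v\<^sup>2 / s\<^sup>2 = 1 + \<kappa>\<^sup>2 * \<tau>\<^sup>2 / s\<^sup>2"
    using s by (simp add: v_sq field_simps)
  finally show ?thesis .
qed

end

section \<open>Asymptotics of the logarithmic sum\<close>

text \<open>The complex reflection formula read on the real line, with \<open>Gamma 1 = 1\<close> in
  the denominator of Beta. It holds for every real \<open>x\<close>: at integers one Gamma factor is
  at a pole, where its value is 0, and the right side is a division by zero.\<close>

lemma Beta_reflection:
  fixes x :: real
  shows "Beta x (1 - x) = pi / sin (pi * x)"
proof -
  have "complex_of_real (Gamma x * Gamma (1 - x)) = Gamma (of_real x) * Gamma (1 - of_real x)"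
    by (simp flip: Gamma_complex_of_real)
  also have "\<dots> = complex_of_real (pi / sin (pi * x))"
    by (simp add: Gamma_reflection_complex flip: sin_of_real)
  finally have "Gamma x * Gamma (1 - x) = pi / sin (pi * x)"
    by (simp only: of_real_eq_iff)
  then show ?thesis by (simp add: Beta_def)
qed

lemma nn_integral_ln_one_plus_powr:
  fixes q c :: real
  assumes q: "q > 1" and c: "c > 0"
  shows "(\<integral>\<^sup>+u. ennreal (ln (1 + c * u powr - q)) * indicator {0<..} u \<partial>lborel)
    = ennreal (pi * c powr (1 / q) * csc (pi / q))"
proof -
  text \<open>Integrating \<open>1 / t\<close> over this region in \<open>t\<close> gives the logarithm, in \<open>u\<close> the Beta density.\<close>
  define R where "R = {(u :: real, t :: real). 0 < u \<and> 0 < t \<and> t \<le> 1 \<and> u powr q * (1 - t) \<le> c * t}"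
  have R [measurable]: "R \<in> sets (lborel \<Otimes>\<^sub>M lborel)"
  proof -
    have "R = {z \<in> space (lborel \<Otimes>\<^sub>M lborel).
        0 < fst z \<and> 0 < snd z \<and> snd z \<le> 1 \<and> fst z powr q * (1 - snd z) \<le> c * snd z}"
      by (auto simp: R_def space_pair_measure)
    also have "\<dots> \<in> sets (lborel \<Otimes>\<^sub>M lborel)" by measurable
    finally show ?thesis .
  qed
  have inner_t: "(\<integral>\<^sup>+t. ennreal (1 / t) * indicator R (u, t) \<partial>lborel)
      = ennreal (ln (1 + c * u powr - q)) * indicator {0<..} u" for u
  proof (cases "u > 0")
    case True
    \<comment> \<open>The constraint of \<open>R\<close> solved for \<open>t\<close>.\<close>
    define T where "T = 1 / (1 + c * u powr - q)"
    have U: "u powr q > 0" "u powr - q = 1 / u powr q" using True by (auto simp: powr_minus_divide)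
    have T: "T > 0" "T \<le> 1" using c U by (auto simp: T_def add_pos_pos)
    have T_eq: "T = u powr q / (u powr q + c)"
      using U c by (simp add: T_def U(2) field_simps)
    have mem: "(u, t) \<in> R \<longleftrightarrow> t \<in> {T..1}" for t
    proof -
      have "u powr q * (1 - t) \<le> c * t \<longleftrightarrow> T \<le> t"
        unfolding T_eq pos_divide_le_eq[OF add_pos_pos[OF U(1) c]] by (simp add: algebra_simps)
      then show ?thesis using True T by (auto simp: R_def)
    qed
    have "(\<integral>\<^sup>+t. ennreal (1 / t) * indicator R (u, t) \<partial>lborel)
        = (\<integral>\<^sup>+t. ennreal (1 / t) * indicator {T..1} t \<partial>lborel)"
      by (intro nn_integral_cong) (auto simp: indicator_def mem)
    also have "\<dots> = ennreal (ln 1 - ln T)"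
      using T by (intro nn_integral_FTC_Icc) (auto intro!: derivative_eq_intros)
    also have "ln 1 - ln T = ln (1 + c * u powr - q)"
      using c U by (simp add: T_def ln_div add_pos_pos)
    finally show ?thesis using True by simp
  qed (simp add: R_def)
  \<comment> \<open>At \<open>t = 1\<close> the constraint holds for every positive \<open>u\<close>
    and the slice has infinite length; this single null value is excluded here and discarded after
    the interchange of integrals.\<close>
  have inner_u: "(\<integral>\<^sup>+u. ennreal (1 / t) * indicator R (u, t) \<partial>lborel)
      = ennreal (c powr (1 / q) * (t powr (1 / q - 1) * (1 - t) powr ((1 - 1 / q) - 1))) * indicator {0<..<1} t"
    if "t \<noteq> 1" for t
  proof (cases "0 < t \<and> t < 1")
    case True
    \<comment> \<open>The constraint solved for \<open>u\<close>. The slice has length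
      \<open>V\<close>, and \<open>V / t\<close> is a constant times the integrand of
      \<open>Beta (1 / q) (1 - 1 / q)\<close>.\<close>
    define V where "V = (c * t / (1 - t)) powr (1 / q)"
    have V: "V > 0" using True c by (simp add: V_def)
    have mem: "(u, t) \<in> R \<longleftrightarrow> u \<in> {0<..V}" for u
    proof -
      have "u powr q * (1 - t) \<le> c * t \<longleftrightarrow> u \<le> V" if "u > 0"
      proof -
        have "u powr q * (1 - t) \<le> c * t \<longleftrightarrow> u powr q \<le> V powr q"
          using True c q by (simp add: V_def powr_powr pos_le_divide_eq)
        also have "\<dots> \<longleftrightarrow> u \<le> V"
          using q that V by (metis linorder_not_le powr_less_mono2 powr_mono2 less_imp_le zero_less_one order.strict_trans)
        finally show ?thesis .
      qed
      then show ?thesis using True by (auto simp: R_def)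
    qed
    have "(\<integral>\<^sup>+u. ennreal (1 / t) * indicator R (u, t) \<partial>lborel)
        = (\<integral>\<^sup>+u. ennreal (1 / t) * indicator {0<..V} u \<partial>lborel)"
      by (intro nn_integral_cong) (auto simp: indicator_def mem)
    also have "\<dots> = ennreal (1 / t * V)"
      using V True by (simp add: nn_integral_cmult flip: ennreal_mult'')
    also have "1 / t * V = c powr (1 / q) * (t powr (1 / q - 1) * (1 - t) powr ((1 - 1 / q) - 1))"
    proof -
      have "V = c powr (1 / q) * t powr (1 / q) * (1 - t) powr (- (1 / q))"
        using True c by (simp add: V_def powr_divide powr_mult powr_minus_divide)
      moreover have "t powr (1 / q - 1) = t powr (1 / q) / t"
        using True by (simp add: powr_diff)
      ultimately show ?thesis by simp
    qed
    finally show ?thesis using True by simp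
  next
    case False
    then have "(u, t) \<notin> R" for u using that by (auto simp: R_def)
    then show ?thesis using False by auto
  qed
  have "(\<integral>\<^sup>+u. ennreal (ln (1 + c * u powr - q)) * indicator {0<..} u \<partial>lborel)
    = (\<integral>\<^sup>+u. \<integral>\<^sup>+t. ennreal (1 / t) * indicator R (u, t) \<partial>lborel \<partial>lborel)"
    unfolding inner_t ..
  also have "\<dots> = (\<integral>\<^sup>+t. \<integral>\<^sup>+u. ennreal (1 / t) * indicator R (u, t) \<partial>lborel \<partial>lborel)"
    by (intro lborel_pair.Fubini'[symmetric]) auto
  also have "\<dots> = (\<integral>\<^sup>+t. ennreal (c powr (1 / q) * (t powr (1 / q - 1) * (1 - t) powr ((1 - 1 / q) - 1))) * indicator {0<..<1} t \<partial>lborel)"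
  proof (rule nn_integral_cong_AE)
    show "AE t in lborel. (\<integral>\<^sup>+u. ennreal (1 / t) * indicator R (u, t) \<partial>lborel)
      = ennreal (c powr (1 / q) * (t powr (1 / q - 1) * (1 - t) powr ((1 - 1 / q) - 1))) * indicator {0<..<1} t"
      using AE_lborel_singleton[of 1] by eventually_elim (rule inner_u)
  qed
  also have "\<dots> = ennreal (c powr (1 / q) * Beta (1 / q) (1 - 1 / q))"
  proof (rule nn_integral_has_integral_lebesgue')
    show "((\<lambda>t. c powr (1 / q) * (t powr (1 / q - 1) * (1 - t) powr ((1 - 1 / q) - 1)))
        has_integral c powr (1 / q) * Beta (1 / q) (1 - 1 / q)) {0<..<1}"
      using has_integral_Beta_real[of "1 / q" "1 - 1 / q"] q
      by (intro has_integral_mult_right) (auto simp: has_integral_Icc_iff_Ioo)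
  qed auto
  also have "c powr (1 / q) * Beta (1 / q) (1 - 1 / q) = pi * c powr (1 / q) * csc (pi / q)"
    by (simp add: Beta_reflection csc_def)
  finally show ?thesis .
qed

section \<open>The logarithmic sum as an integral\<close>

text \<open>On the cell from \<open>j * h\<close> (excluded) to \<open>Suc j * h\<close> (included)
  the ceiling equals \<open>Suc j\<close>, so each term of the series is spread over a cell of
  length \<open>h\<close>. For \<open>u > 0\<close> the index is at least 1, which is why the series
  starts at \<open>F 1\<close>.\<close>

lemma nn_integral_step:
  fixes F :: "nat \<Rightarrow> real"
  assumes h: "h > 0" and F: "\<And>j. F j \<ge> 0" and summ: "summable (\<lambda>j. F (Suc j))"
  shows "(\<integral>\<^sup>+u. ennreal (F (nat \<lceil>u / h\<rceil>)) * indicator {0<..} u \<partial>lborel) = ennreal (h * (\<Sum>j. F (Suc j)))"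
proof -
  have eq: "ennreal (F (nat \<lceil>u / h\<rceil>)) * indicator {0<..} u
    = (\<Sum>j. ennreal (F (Suc j)) * indicator {real j * h<..real (Suc j) * h} u)" for u
  proof (cases "u > 0")
    case True
    define k where "k = nat \<lceil>u / h\<rceil> - 1"
    have c1: "\<lceil>u / h\<rceil> \<ge> 1" using True h by (simp add: One_nat_def)
    then have Suc_k: "nat \<lceil>u / h\<rceil> = Suc k" by (simp add: k_def)
    have mem: "u \<in> {real j * h<..real (Suc j) * h} \<longleftrightarrow> j = k" for j
    proof -
      have "u \<in> {real j * h<..real (Suc j) * h} \<longleftrightarrow> real j < u / h \<and> u / h \<le> real j + 1"
        using h by (auto simp: field_simps)
      also have "\<dots> \<longleftrightarrow> \<lceil>u / h\<rceil> = int j + 1" by (auto simp: ceiling_eq_iff)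
      also have "\<dots> \<longleftrightarrow> j = k" using Suc_k c1 by linarith
      finally show ?thesis .
    qed
    have "(\<Sum>j. ennreal (F (Suc j)) * indicator {real j * h<..real (Suc j) * h} u)
      = (\<Sum>j\<in>{k}. ennreal (F (Suc j)) * indicator {real j * h<..real (Suc j) * h} u)"
      using mem by (intro suminf_finite) (auto simp: indicator_def simp del: of_nat_Suc greaterThanAtMost_iff)
    also have "\<dots> = ennreal (F (Suc k))" using mem[of k] by simp
    finally show ?thesis using True Suc_k by simp
  next
    case False
    have "u \<notin> {real j * h<..real (Suc j) * h}" for j
    proof -
      have "u \<le> 0" "0 \<le> real j * h" using False h by auto
      then show ?thesis unfolding greaterThanAtMost_iff by linarith
    qed
    then show ?thesis using False by simp
  qed
  have "(\<integral>\<^sup>+u. ennreal (F (nat \<lceil>u / h\<rceil>)) * indicator {0<..} u \<partial>lborel)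
    = (\<Sum>j. \<integral>\<^sup>+u. ennreal (F (Suc j)) * indicator {real j * h<..real (Suc j) * h} u \<partial>lborel)"
    unfolding eq by (intro nn_integral_suminf) auto
  also have "\<dots> = (\<Sum>j. ennreal (h * F (Suc j)))"
    using h F by (intro suminf_cong) (simp add: nn_integral_cmult algebra_simps ennreal_mult')
  also have "\<dots> = ennreal (h * (\<Sum>j. F (Suc j)))"
    using h F summ by (subst suminf_ennreal2) (auto simp: suminf_mult intro: summable_mult)
  finally show ?thesis .
qed

text \<open>The scale \<open>n powr (1 / q)\<close> is the one at which \<open>n * a j\<close> is of
  order one: at \<open>j\<close> close to \<open>u * n powr (1 / q)\<close> it is close to
  \<open>c * u powr - q\<close>.\<close>

lemma sum_ln_one_plus_asymp:
  fixes a :: "nat \<Rightarrow> real"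
  assumes a_nonneg: "\<And>j. j \<ge> 1 \<Longrightarrow> a j \<ge> 0" and q: "q > 1" and c: "c > 0"
    and asymp: "a \<sim>[sequentially] (\<lambda>j. c * real j powr (- q))"
  shows "summable (\<lambda>j. a (Suc j))"
    and "((\<lambda>n. n powr (- 1 / q) * (\<Sum>j. ln (1 + n * a (Suc j)))) \<longlongrightarrow> pi * c powr (1 / q) * csc (pi / q)) at_top"
proof -
  have lim_c: "(\<lambda>j. a j * real j powr q) \<longlonglongrightarrow> c"
  proof -
    \<comment> \<open>Asymptotic equivalence counts the quotient 0/0 as 1; passing to the plain
      quotient needs one side to be nonzero eventually.\<close>
    have nz: "\<forall>\<^sub>F j in sequentially. a j \<noteq> 0 \<or> c * real j powr - q \<noteq> 0"
      using eventually_gt_at_top[of 0] by eventually_elim (use c in auto)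
    have "(\<lambda>j. c * (a j / (c * real j powr - q))) \<longlonglongrightarrow> c * 1"
      by (intro tendsto_mult tendsto_const asymp_equivD_strong[OF asymp nz])
    moreover have "\<forall>\<^sub>F j in sequentially. c * (a j / (c * real j powr - q)) = a j * real j powr q"
      using eventually_gt_at_top[of 0] by eventually_elim (use c in \<open>simp add: powr_minus_divide\<close>)
    ultimately have "(\<lambda>j. a j * real j powr q) \<longlonglongrightarrow> c * 1" by (rule Lim_transform_eventually)
    then show ?thesis by simp
  qed
  then have "Bseq (\<lambda>j. a j * real j powr q)" by (intro convergent_imp_Bseq) (auto simp: convergent_def)
  then obtain C where C: "C > 0" "\<And>j. \<bar>a j * real j powr q\<bar> \<le> C" by (auto simp: Bseq_def)
  \<comment> \<open>Convergence of \<open>a j * real j powr q\<close> makes it bounded, so the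
    asymptotic rate becomes an upper bound at every index, with \<open>C\<close> in place of
    \<open>c\<close>.\<close>
  have bound: "a j \<le> C * real j powr - q" if "j \<ge> 1" for j
  proof -
    have "a j * real j powr q \<le> C" using C(2)[of j] by linarith
    then show ?thesis using that by (simp add: powr_minus_divide pos_le_divide_eq)
  qed
  show summ: "summable (\<lambda>j. a (Suc j))"
  proof (rule summable_comparison_test')
    have "summable (\<lambda>j. real j powr - q)" using q by (subst summable_real_powr_iff) simp
    then show "summable (\<lambda>j. C * real (Suc j) powr - q)"
      by (intro summable_mult) (subst summable_Suc_iff)
    show "norm (a (Suc j)) \<le> C * real (Suc j) powr - q" if "j \<ge> 0" for j
      using a_nonneg[of "Suc j"] bound[of "Suc j"] by (simp add: One_nat_def del: of_nat_Suc)
  qed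
  define s where "s n u = ln (1 + n * a (nat \<lceil>u * n powr (1 / q)\<rceil>)) * indicator {0<..} u" for n u :: real
  define w where "w u = ln (1 + C * u powr - q) * indicator {0<..} u" for u :: real
  define g where "g u = ln (1 + c * u powr - q) * indicator {0<..} u" for u :: real
  have s_meas [measurable]: "s n \<in> borel_measurable lborel" for n unfolding s_def by measurable
  \<comment> \<open>Stated for general \<open>d\<close>: at \<open>c\<close> it evaluates the limit
    integral, at \<open>C\<close> it shows that the majorant \<open>w\<close> is integrable.\<close>
  have nn_g: "(\<integral>\<^sup>+u. ennreal (ln (1 + d * u powr - q) * indicator {0<..} u) \<partial>lborel)
      = ennreal (pi * d powr (1 / q) * csc (pi / q))" if "d > 0" for d
    using nn_integral_ln_one_plus_powr[OF q that] by (simp add: ennreal_mult'' ennreal_indicator)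
  have csc_pos: "csc (pi / q) > 0"
    using q by (auto simp: csc_def intro!: sin_gt_zero simp: field_simps)
  have g_int: "(\<integral>u. g u \<partial>lborel) = pi * c powr (1 / q) * csc (pi / q)"
    using nn_g[OF c] csc_pos c unfolding g_def
    by (subst integral_eq_nn_integral) (auto simp: indicator_def)
  have w_int: "integrable lborel w"
    using nn_g[OF C(1)] C(1) unfolding w_def
    by (intro integrableI_nn_integral_finite) (auto simp: indicator_def)
  have lim: "((\<lambda>n. s n u) \<longlongrightarrow> g u) at_top" for u
  proof (cases "u > 0")
    case True
    define J where "J n = nat \<lceil>u * n powr (1 / q)\<rceil>" for n :: real
    have m_top: "filterlim (\<lambda>n::real. n powr (1 / q)) at_top at_top"
      using q by real_asymp
    have J_top: "filterlim J at_top at_top"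
      unfolding filterlim_at_top
    proof (rule allI)
      fix Z :: nat
      have "filterlim (\<lambda>n::real. u * n powr (1 / q)) at_top at_top"
        using True by (rule filterlim_tendsto_pos_mult_at_top[OF tendsto_const _ m_top])
      then have "\<forall>\<^sub>F n in at_top. real Z \<le> u * n powr (1 / q)" by (simp add: filterlim_at_top)
      then show "\<forall>\<^sub>F n in at_top. Z \<le> J n"
      proof eventually_elim
        case (elim n)
        then have "real Z \<le> real (J n)" unfolding J_def by (rule order_trans[OF _ real_nat_ceiling_ge])
        then show ?case by simp
      qed
    qed
    have "((\<lambda>n. real (J n) / n powr (1 / q)) \<longlongrightarrow> u) at_top"
    proof (rule tendsto_sandwich[where f = "\<lambda>_. u" and h = "\<lambda>n. u + 1 / n powr (1 / q)"])
      show "\<forall>\<^sub>F n in at_top. u \<le> real (J n) / n powr (1 / q)"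
        using eventually_gt_at_top[of 0]
      proof eventually_elim
        case (elim n)
        have "u * n powr (1 / q) \<le> real (J n)" unfolding J_def by (rule real_nat_ceiling_ge)
        then show ?case using elim by (simp add: pos_le_divide_eq)
      qed
      show "\<forall>\<^sub>F n in at_top. real (J n) / n powr (1 / q) \<le> u + 1 / n powr (1 / q)"
        using eventually_gt_at_top[of 0]
      proof eventually_elim
        case (elim n)
        have "u * n powr (1 / q) \<ge> 0" using True by simp
        then have "real (J n) \<le> u * n powr (1 / q) + 1" unfolding J_def by linarith
        then show ?case using elim by (simp add: pos_divide_le_eq field_simps)
      qed
      have "((\<lambda>n::real. 1 / n powr (1 / q)) \<longlongrightarrow> 0) at_top" using q by real_asymp
      from tendsto_add[OF tendsto_const this] show "((\<lambda>n. u + 1 / n powr (1 / q)) \<longlongrightarrow> u) at_top" by simp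
    qed simp
    \<comment> \<open>Splitting \<open>n * a (J n)\<close> in this way separates the two limits: the
      first factor tends to \<open>c\<close> because \<open>J n\<close> tends to infinity, the
      second to \<open>u powr - q\<close> because rounding up costs at most
      \<open>1 / n powr (1 / q)\<close>.\<close>
    then have "((\<lambda>n. (a (J n) * real (J n) powr q) * (real (J n) / n powr (1 / q)) powr - q) \<longlongrightarrow> c * u powr - q) at_top"
      using True by (intro tendsto_intros filterlim_compose[OF lim_c J_top]) auto
    moreover have "\<forall>\<^sub>F n in at_top. (a (J n) * real (J n) powr q) * (real (J n) / n powr (1 / q)) powr - q = n * a (J n)"
      using eventually_gt_at_top[of 0] filterlim_at_top[THEN iffD1, OF J_top, rule_format, of 1]
    proof eventually_elim
      case (elim n)
      have "(real (J n) / n powr (1 / q)) powr - q = n / real (J n) powr q"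
        using elim q by (simp add: powr_divide powr_powr powr_minus_divide)
      then show ?case using elim by simp
    qed
    ultimately have "((\<lambda>n. n * a (J n)) \<longlongrightarrow> c * u powr - q) at_top"
      by (rule Lim_transform_eventually)
    then have "((\<lambda>n. ln (1 + n * a (J n))) \<longlongrightarrow> ln (1 + c * u powr - q)) at_top"
      using add_pos_nonneg[of 1 "c * u powr - q"] c
      by (intro tendsto_ln tendsto_add tendsto_const) auto
    then show ?thesis using True by (simp add: s_def g_def J_def)
  qed (simp add: s_def g_def)
  have s_bound: "norm (s n u) \<le> w u" and s_nonneg: "s n u \<ge> 0" if n: "n > 0" for n u
  proof -
    have "0 \<le> s n u \<and> s n u \<le> w u"
    proof (cases "u > 0")
      case True
      define j where "j = nat \<lceil>u * n powr (1 / q)\<rceil>"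
      have x: "u * n powr (1 / q) > 0" using True n by simp
      have jx: "u * n powr (1 / q) \<le> real j" unfolding j_def by (rule real_nat_ceiling_ge)
      then have j: "j \<ge> 1" using x by (simp add: One_nat_def)
      \<comment> \<open>Rounding up only increases the index, and the power with exponent
        \<open>- q\<close> decreases, so replacing \<open>j\<close> by
        \<open>u * n powr (1 / q)\<close> gives a bound in which \<open>n\<close> cancels.\<close>
      have "n * a j \<le> n * (C * real j powr - q)" using n by (intro mult_left_mono bound j) auto
      also have "\<dots> \<le> n * (C * (u * n powr (1 / q)) powr - q)"
        using n C(1) x jx q by (intro mult_left_mono powr_mono2') auto
      also have "(u * n powr (1 / q)) powr - q = u powr - q / n"
        using True n q by (simp add: powr_mult powr_powr powr_minus_divide)
      also have "n * (C * (u powr - q / n)) = C * u powr - q" using n by simp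
      finally have le: "n * a j \<le> C * u powr - q" .
      have "n * a j \<ge> 0" using a_nonneg[OF j] n by simp
      then show ?thesis using le True by (simp add: s_def w_def j_def[symmetric] ln_le_cancel_iff)
    qed (simp add: s_def w_def)
    then show "norm (s n u) \<le> w u" "s n u \<ge> 0" by auto
  qed
  have "((\<lambda>n. \<integral>u. s n u \<partial>lborel) \<longlongrightarrow> (\<integral>u. g u \<partial>lborel)) at_top"
  proof (rule integral_dominated_convergence_at_top[OF _ s_meas w_int])
    show "g \<in> borel_measurable lborel" unfolding g_def by measurable
    show "\<forall>\<^sub>F n in at_top. AE u in lborel. norm (s n u) \<le> w u"
      using eventually_gt_at_top[of 0] by eventually_elim (use s_bound in auto)
  qed (use lim in auto)
  moreover have "\<forall>\<^sub>F n in at_top. (\<integral>u. s n u \<partial>lborel) = n powr (- 1 / q) * (\<Sum>j. ln (1 + n * a (Suc j)))"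
    using eventually_gt_at_top[of 0]
  proof eventually_elim
    case (elim n)
    text \<open>The value \<open>a 0\<close> is arbitrary.\<close>
    define F where "F j = (if j = 0 then 0 else ln (1 + n * a j))" for j
    have F: "F j \<ge> 0" for j using elim a_nonneg[of j] by (simp add: F_def One_nat_def)
    have h: "n powr (- 1 / q) > 0" "u / n powr (- 1 / q) = u * n powr (1 / q)" for u
      using elim by (auto simp: powr_minus_divide)
    have summF: "summable (\<lambda>j. F (Suc j))"
    proof (rule summable_comparison_test')
      show "summable (\<lambda>j. n * a (Suc j))" by (intro summable_mult summ)
      show "norm (F (Suc j)) \<le> n * a (Suc j)" if "j \<ge> 0" for j
        using F[of "Suc j"] ln_add_one_self_le_self[of "n * a (Suc j)"] elim a_nonneg[of "Suc j"]
        by (simp add: F_def One_nat_def)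
    qed
    have "s n u = F (nat \<lceil>u / n powr (- 1 / q)\<rceil>) * indicator {0<..} u" for u
      unfolding s_def F_def h(2) using elim by (auto simp: indicator_def mult_le_0_iff)
    then have "(\<integral>\<^sup>+u. ennreal (s n u) \<partial>lborel) = ennreal (n powr (- 1 / q) * (\<Sum>j. F (Suc j)))"
      using nn_integral_step[OF h(1) F summF] by (simp add: ennreal_mult'' ennreal_indicator)
    moreover have "(\<Sum>j. F (Suc j)) \<ge> 0" by (intro suminf_nonneg summF F)
    ultimately have "(\<integral>u. s n u \<partial>lborel) = n powr (- 1 / q) * (\<Sum>j. F (Suc j))"
      using s_nonneg[OF elim] by (subst integral_eq_nn_integral) auto
    then show ?case by (simp add: F_def)
  qed
  ultimately show "((\<lambda>n. n powr (- 1 / q) * (\<Sum>j. ln (1 + n * a (Suc j)))) \<longlongrightarrow> pi * c powr (1 / q) * csc (pi / q)) at_top"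
    unfolding g_int by (rule Lim_transform_eventually)
qed

section \<open>Mutual information of the sequence experiment\<close>

text \<open>The joint law and the product of the marginal laws are the images under
  \<open>unzip\<close> of two product measures over the pairs. As \<open>unzip\<close> has a
  measurable left inverse, their density and its entropy carry over unchanged, and each pair
  contributes half a logarithm.\<close>

lemma seq_mutual_info_sums:
  fixes M :: "'a measure"
    and \<theta> \<epsilon> :: "nat \<Rightarrow> 'a \<Rightarrow> real"
    and \<kappa> \<tau> a :: "nat \<Rightarrow> real"
  assumes prob: "prob_space M"
    and \<kappa>_pos: "\<And>j. j \<ge> 1 \<Longrightarrow> \<kappa> j > 0"
    and \<tau>_pos: "\<And>j. j \<ge> 1 \<Longrightarrow> \<tau> j > 0"
    and \<sigma>_pos: "\<sigma> > 0"
    and prior: "\<And>j. j \<ge> 1 \<Longrightarrow> distributed M lborel (\<theta> j) (normal_density 0 (\<tau> j))"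
    and noise: "\<And>j. j \<ge> 1 \<Longrightarrow> distributed M lborel (\<epsilon> j) (normal_density 0 \<sigma>)"
    and indep: "prob_space.indep_vars M (\<lambda>_. borel) (case_sum \<theta> \<epsilon>) ({1..} <+> {1..})"
    and a_def: "\<And>j. j \<ge> 1 \<Longrightarrow> a j = (\<kappa> j)\<^sup>2 * (\<tau> j)\<^sup>2 / \<sigma>\<^sup>2"
    and summ: "summable (\<lambda>j. a (Suc j))" and n: "n > 0"
  shows "(\<lambda>j. ln (1 + n * a (Suc j))) sums (2 * seq_mutual_info M \<kappa> \<theta> \<epsilon> n)"
proof -
  interpret prob_space M by (rule prob)
  \<comment> \<open>The noise level once the factor \<open>n powr (-1/2)\<close> is absorbed; the
    ratio \<open>\<kappa>\<^sup>2 * \<tau>\<^sup>2 / s\<^sup>2\<close> of the scalar channel then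
    becomes \<open>n * a j\<close>.\<close>
  define s where "s = n powr (-1/2) * \<sigma>"
  have s: "s > 0" using n \<sigma>_pos by (simp add: s_def)
  have s_sq: "s\<^sup>2 = \<sigma>\<^sup>2 / n"
    using n by (simp add: s_def power_divide powr_minus_divide powr_half_sqrt)
  define E where "E j \<omega> = n powr (-1/2) * \<epsilon> j \<omega>" for j \<omega>
  have E_dist: "distributed M lborel (E j) (normal_density 0 s)" if "j \<ge> 1" for j
    using normal_density_affine[OF noise[OF that] \<sigma>_pos, of "n powr (-1/2)" 0] n
    by (simp add: E_def[abs_def] s_def)
  have "indep_vars (\<lambda>_. borel) (\<lambda>k \<omega>. (case_sum (\<lambda>_ x. x) (\<lambda>_ x. n powr (-1/2) * x) k :: real \<Rightarrow> real) (case_sum \<theta> \<epsilon> k \<omega>)) ({1..} <+> {1..})"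
    by (rule indep_vars_compose2[OF indep]) (auto split: sum.split)
  also have "?this \<longleftrightarrow> indep_vars (\<lambda>_. borel) (case_sum \<theta> E) ({1..} <+> {1..})"
    by (intro indep_vars_cong) (auto simp: E_def[abs_def])
  finally have indE: "indep_vars (\<lambda>_. borel) (case_sum \<theta> E) ({1..} <+> {1..})" .
  have ch: "gauss_channel_model (\<kappa> j) (\<tau> j) s M (\<theta> j) (E j)" if j: "j \<ge> 1" for j
  proof -
    interpret gauss_channel "\<kappa> j" "\<tau> j" s by standard (use \<kappa>_pos \<tau>_pos s j in auto)
    show ?thesis
      by standard (use indep_var_zip[OF indE, of j] prior E_dist j in auto)
  qed
  define Y where "Y = seq_obs \<kappa> \<theta> \<epsilon> n"
  have Y_eq: "Y j \<omega> = \<kappa> j * \<theta> j \<omega> + E j \<omega>" for j \<omega> by (simp add: Y_def seq_obs_def E_def)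
  have "indep_vars (\<lambda>j. borel \<Otimes>\<^sub>M borel) (\<lambda>j \<omega>. (\<theta> j \<omega>, E j \<omega>)) {1..}"
    using indep_vars_zip[OF indE] by simp
  then have "indep_vars (\<lambda>j. borel \<Otimes>\<^sub>M borel) (\<lambda>j \<omega>. (\<lambda>(x, e). (x, \<kappa> j * x + e)) (\<theta> j \<omega>, E j \<omega>)) {1..}"
    by (rule indep_vars_compose2) measurable
  then have W: "indep_vars (\<lambda>j. borel \<Otimes>\<^sub>M borel) (\<lambda>j \<omega>. (\<theta> j \<omega>, Y j \<omega>)) {1..}"
    by (simp add: Y_eq)
  have ind_\<theta>: "indep_vars (\<lambda>j. borel) \<theta> {1..}" and ind_Y: "indep_vars (\<lambda>j. borel) Y {1..}"
    using indep_vars_compose2[OF W, of "\<lambda>_. fst" "\<lambda>_. borel"] indep_vars_compose2[OF W, of "\<lambda>_. snd" "\<lambda>_. borel"]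
    by simp_all
  have rv: "\<theta> j \<in> borel_measurable M" "Y j \<in> borel_measurable M" if "j \<ge> 1" for j
    using ind_\<theta> ind_Y that by (auto simp: indep_vars_def)
  define w where "w j = gauss_channel.v (\<kappa> j) (\<tau> j) s" for j
  define Q where "Q j = gauss (\<tau> j) \<Otimes>\<^sub>M gauss (w j)" for j
  define f where "f j = channel_ratio (\<kappa> j) (\<tau> j) s" for j
  have w_pos: "w j > 0" if "j \<ge> 1" for j
  proof -
    interpret gauss_channel_model "\<kappa> j" "\<tau> j" s M "\<theta> j" "E j" by (rule ch[OF that])
    show ?thesis using v_pos by (simp add: w_def)
  qed
  have pA: "prob_space (gauss (\<tau> j))" and pB: "prob_space (gauss (w j))" if "j \<ge> 1" for j
    using prob_space_normal_density \<tau>_pos[OF that] w_pos[OF that] by auto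
  have pQ: "prob_space (Q j)" if "j \<ge> 1" for j
  proof -
    interpret A: prob_space "gauss (\<tau> j)" by (rule pA[OF that])
    interpret B: prob_space "gauss (w j)" by (rule pB[OF that])
    interpret pair_prob_space "gauss (\<tau> j)" "gauss (w j)" ..
    show ?thesis unfolding Q_def by (rule P.prob_space_axioms)
  qed
  have setsQ [measurable_cong]: "sets (Q j) = sets (borel \<Otimes>\<^sub>M borel)" for j
    unfolding Q_def by (intro sets_pair_measure_cong) auto
  have distrW: "distr M (borel \<Otimes>\<^sub>M borel) (\<lambda>\<omega>. (\<theta> j \<omega>, Y j \<omega>)) = density (Q j) (f j)"
    and distrY: "distr M borel (Y j) = gauss (w j)"
    and f_meas: "f j \<in> borel_measurable (Q j)"
    and f_pos: "f j x > 0"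
    and f_sq: "(\<integral>\<^sup>+x. (f j x)\<^sup>2 \<partial>Q j) = ennreal (1 + n * a j)"
    and f_ln: "(\<integral>x. ln (f j x) \<partial>density (Q j) (f j)) = ln (1 + n * a j) / 2"
    if j: "j \<ge> 1" for j x
  proof -
    interpret gauss_channel_model "\<kappa> j" "\<tau> j" s M "\<theta> j" "E j" by (rule ch[OF j])
    have na: "(\<kappa> j)\<^sup>2 * (\<tau> j)\<^sup>2 / s\<^sup>2 = n * a j" using n by (simp add: s_sq a_def[OF j])
    show "distr M (borel \<Otimes>\<^sub>M borel) (\<lambda>\<omega>. (\<theta> j \<omega>, Y j \<omega>)) = density (Q j) (f j)"
      using distr_channel by (simp add: Y_eq Q_def f_def w_def)
    have "distr M borel (Y j) = distr M lborel (Y j)" by (intro distr_cong) auto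
    also have "\<dots> = gauss (w j)"
      using distributed_distr_eq_density[OF output_distributed] by (simp add: Y_eq[abs_def] w_def)
    finally show "distr M borel (Y j) = gauss (w j)" .
    show "f j \<in> borel_measurable (Q j)" unfolding f_def by measurable
    show "f j x > 0" unfolding f_def by (rule channel_ratio_pos)
    show "(\<integral>\<^sup>+x. (f j x)\<^sup>2 \<partial>Q j) = ennreal (1 + n * a j)"
      using channel_ratio_second_moment by (simp add: f_def Q_def w_def na)
    show "(\<integral>x. ln (f j x) \<partial>density (Q j) (f j)) = ln (1 + n * a j) / 2"
      using channel_information by (simp add: f_def Q_def w_def na)
  qed
  \<comment> \<open>The ratio has mass one because its density measure is the law of a random pair;
    no integral is computed.\<close>
  have f_int: "(\<integral>\<^sup>+x. f j x \<partial>Q j) = 1" if j: "j \<ge> 1" for j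
  proof -
    have "prob_space (density (Q j) (f j))"
      unfolding distrW[OF j, symmetric] using rv[OF j] by (intro prob_space_distr) auto
    then show ?thesis
      using prob_space.emeasure_space_1[of "density (Q j) (f j)"] f_meas[OF j]
      by (simp add: emeasure_density cong: nn_integral_cong_simp)
  qed
  have na_nonneg: "n * a j \<ge> 0" if "j \<ge> 1" for j using n by (simp add: a_def[OF that])
  interpret D: product_density_ratio Q f "\<lambda>j. n * a j"
  proof (rule product_density_ratio.intro)
    show "prob_space (Q j)" if "1 \<le> j" for j using that by (rule pQ)
    show "f j \<in> borel_measurable (Q j)" if "1 \<le> j" for j using that by (rule f_meas)
    show "0 < f j x" if "1 \<le> j" for j x using that by (rule f_pos)
    show "(\<integral>\<^sup>+x. f j x \<partial>Q j) = 1" if "1 \<le> j" for j using that by (rule f_int)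
    show "(\<integral>\<^sup>+x. (f j x)\<^sup>2 \<partial>Q j) = ennreal (1 + n * a j)" if "1 \<le> j" for j using that by (rule f_sq)
    show "0 \<le> n * a j" if "1 \<le> j" for j using that by (rule na_nonneg)
    show "summable (\<lambda>j. n * a (Suc j))" using summ by (rule summable_mult)
  qed
  obtain l where l_meas [measurable]: "l \<in> borel_measurable D.QQ" and l_nonneg: "\<And>x. l x \<ge> 0"
    and PP: "D.PP = density D.QQ (\<lambda>x. ennreal (l x))"
    and sums: "(\<lambda>j. \<integral>x. ln (f (Suc j) x) \<partial>density (Q (Suc j)) (f (Suc j))) sums (\<integral>x. l x * ln (l x) \<partial>D.QQ)"
    by (rule D.product_density_relative_entropy, rule that)
  define QJ where "QJ = PiM {1..} (\<lambda>j. gauss (\<tau> j)) \<Otimes>\<^sub>M PiM {1..} (\<lambda>j. gauss (w j))"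
  have QJ: "QJ = distr D.QQ QJ (unzip {1..})"
    using pair_PiM_eq_distr_unzip[of "{1..}" "\<lambda>j. gauss (\<tau> j)" "\<lambda>j. gauss (w j)"] pA pB
    unfolding QJ_def Q_def by auto
  have unzip_QJ [measurable]: "unzip {1..} \<in> D.QQ \<rightarrow>\<^sub>M QJ"
    unfolding QJ_def Q_def by (rule measurable_unzip)
  have zip_QJ [measurable]: "zip_fun {1..} \<in> QJ \<rightarrow>\<^sub>M D.QQ"
    unfolding QJ_def Q_def by (rule measurable_zip_fun)
  have zip_unzip: "zip_fun {1..} (unzip {1..} x) = x" if "x \<in> space D.QQ" for x
    using that by (intro zip_fun_unzip) (auto simp: space_PiM PiE_def)
  have sets_QJ: "sets QJ = sets (seq_space \<Otimes>\<^sub>M seq_space)"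
    unfolding QJ_def by (intro sets_pair_measure_cong sets_PiM_cong) auto
  interpret QJ: prob_space QJ
    by (subst QJ) (intro D.QQ.prob_space_distr unzip_QJ)
  have "distr M seq_space (as_seq \<theta>) = PiM {1..} (\<lambda>j. distr M borel (\<theta> j))"
    using ind_\<theta> rv by (subst (asm) indep_vars_iff_distr_eq_PiM') (auto simp: as_seq_def[abs_def])
  also have "\<dots> = PiM {1..} (\<lambda>j. gauss (\<tau> j))"
  proof (rule PiM_cong[OF refl])
    fix j :: nat assume "j \<in> {1..}"
    then have "distr M lborel (\<theta> j) = gauss (\<tau> j)"
      by (intro distributed_distr_eq_density prior) simp
    then show "distr M borel (\<theta> j) = gauss (\<tau> j)"
      by (metis distr_cong sets_lborel)
  qed
  finally have marg_\<theta>: "distr M seq_space (as_seq \<theta>) = PiM {1..} (\<lambda>j. gauss (\<tau> j))" .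
  have "distr M seq_space (as_seq Y) = PiM {1..} (\<lambda>j. distr M borel (Y j))"
    using ind_Y rv by (subst (asm) indep_vars_iff_distr_eq_PiM') (auto simp: as_seq_def[abs_def])
  also have "\<dots> = PiM {1..} (\<lambda>j. gauss (w j))" by (intro PiM_cong distrY) auto
  finally have marg_Y: "distr M seq_space (as_seq Y) = PiM {1..} (\<lambda>j. gauss (w j))" .
  have W_meas: "(\<lambda>\<omega>. \<lambda>j\<in>{1..}. (\<theta> j \<omega>, Y j \<omega>)) \<in> M \<rightarrow>\<^sub>M D.QQ"
    using rv by (intro measurable_restrict) auto
  have "distr M (PiM {1..} (\<lambda>j. borel \<Otimes>\<^sub>M borel)) (\<lambda>\<omega>. \<lambda>j\<in>{1..}. (\<theta> j \<omega>, Y j \<omega>))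
      = PiM {1..} (\<lambda>j. distr M (borel \<Otimes>\<^sub>M borel) (\<lambda>\<omega>. (\<theta> j \<omega>, Y j \<omega>)))"
    using W rv by (subst (asm) indep_vars_iff_distr_eq_PiM') auto
  also have "\<dots> = D.PP" by (intro PiM_cong distrW) auto
  also have "distr M (PiM {1..} (\<lambda>j. borel \<Otimes>\<^sub>M borel)) (\<lambda>\<omega>. \<lambda>j\<in>{1..}. (\<theta> j \<omega>, Y j \<omega>))
      = distr M D.QQ (\<lambda>\<omega>. \<lambda>j\<in>{1..}. (\<theta> j \<omega>, Y j \<omega>))"
    by (intro distr_cong sets_PiM_cong) (auto simp: setsQ)
  finally have joint: "distr M D.QQ (\<lambda>\<omega>. \<lambda>j\<in>{1..}. (\<theta> j \<omega>, Y j \<omega>)) = D.PP" .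
  have "distr M (seq_space \<Otimes>\<^sub>M seq_space) (\<lambda>\<omega>. (as_seq \<theta> \<omega>, as_seq Y \<omega>))
    = distr M QJ (unzip {1..} \<circ> (\<lambda>\<omega>. \<lambda>j\<in>{1..}. (\<theta> j \<omega>, Y j \<omega>)))"
    by (intro distr_cong) (auto simp: sets_QJ unzip_def as_seq_def fun_eq_iff)
  also have "\<dots> = distr D.PP QJ (unzip {1..})"
    by (subst distr_distr[symmetric, OF unzip_QJ W_meas]) (simp add: joint)
  \<comment> \<open>A density can be pushed through a map only if it factors through that map;
    inserting \<open>zip_fun\<close> after \<open>unzip\<close>, the identity on the space, puts
    \<open>l\<close> in this form.\<close>
  also have "\<dots> = distr (density D.QQ (\<lambda>x. ennreal (l (zip_fun {1..} (unzip {1..} x))))) QJ (unzip {1..})"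
    unfolding PP by (intro arg_cong[where f = "\<lambda>N. distr N QJ (unzip {1..})"] density_cong) (auto simp: zip_unzip)
  also have "\<dots> = density (distr D.QQ QJ (unzip {1..})) (\<lambda>u. ennreal (l (zip_fun {1..} u)))"
    by (rule density_distr[symmetric]) measurable
  finally have joint_eq: "distr M (seq_space \<Otimes>\<^sub>M seq_space) (\<lambda>\<omega>. (as_seq \<theta> \<omega>, as_seq Y \<omega>))
      = density QJ (\<lambda>u. ennreal (l (zip_fun {1..} u)))"
    by (simp only: QJ[symmetric])
  have "seq_mutual_info M \<kappa> \<theta> \<epsilon> n = KL_divergence (exp 1) QJ (density QJ (\<lambda>u. ennreal (l (zip_fun {1..} u))))"
    unfolding seq_mutual_info_def mutual_information_def Y_def[symmetric] marg_\<theta> marg_Y joint_eq QJ_def ..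
  \<comment> \<open>With a density at hand the divergence is an explicit integral, and base
    \<open>exp 1\<close> turns \<open>log\<close> into \<open>ln\<close>.\<close>
  also have "\<dots> = (\<integral>u. l (zip_fun {1..} u) * ln (l (zip_fun {1..} u)) \<partial>QJ)"
    by (subst QJ.KL_density) (auto simp: l_nonneg log_def)
  also have "\<dots> = (\<integral>x. l (zip_fun {1..} (unzip {1..} x)) * ln (l (zip_fun {1..} (unzip {1..} x))) \<partial>D.QQ)"
    by (subst QJ, rule integral_distr) measurable
  also have "\<dots> = (\<integral>x. l x * ln (l x) \<partial>D.QQ)"
    by (intro Bochner_Integration.integral_cong) (auto simp: zip_unzip)
  finally have "(\<lambda>j. ln (1 + n * a (Suc j)) / 2) sums seq_mutual_info M \<kappa> \<theta> \<epsilon> n"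
    using sums f_ln by (simp add: One_nat_def)
  from sums_mult[OF this, of 2] show ?thesis by simp
qed

theorem corollary2:
  fixes M :: "'a measure"
    and \<theta> \<epsilon> :: "nat \<Rightarrow> 'a \<Rightarrow> real"
    and \<kappa> \<tau> a :: "nat \<Rightarrow> real"
    and \<sigma> c q :: real
  assumes prob: "prob_space M"
    and \<kappa>_pos: "\<And>j. j \<ge> 1 \<Longrightarrow> \<kappa> j > 0"
    and \<tau>_pos: "\<And>j. j \<ge> 1 \<Longrightarrow> \<tau> j > 0"
    and \<sigma>_pos: "\<sigma> > 0"
    and prior: "\<And>j. j \<ge> 1 \<Longrightarrow> distributed M lborel (\<theta> j) (normal_density 0 (\<tau> j))"
    and noise: "\<And>j. j \<ge> 1 \<Longrightarrow> distributed M lborel (\<epsilon> j) (normal_density 0 \<sigma>)"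
    and indep: "prob_space.indep_vars M (\<lambda>_. borel) (case_sum \<theta> \<epsilon>) ({1..} <+> {1..})"
    and a_def: "\<And>j. j \<ge> 1 \<Longrightarrow> a j = (\<kappa> j)\<^sup>2 * (\<tau> j)\<^sup>2 / \<sigma>\<^sup>2"
    and a_decreasing: "antimono_on {1..} a"
    and q: "q > 1"
    and c: "c > 0"
    and a_asymp: "a \<sim>[sequentially] (\<lambda>j. c * real j powr (- q))"
  shows "((\<lambda>n. 2 * seq_mutual_info M \<kappa> \<theta> \<epsilon> n)
           \<sim>[at_top] (\<lambda>n. pi * c powr (1 / q) * csc (pi / q) * n powr (1 / q)))
       \<and> (eff_dim M \<kappa> \<theta> \<epsilon>
           \<sim>[at_top] (\<lambda>n. pi * c powr (1 / q) * csc (pi / q) * (n powr (1 / q) / ln n)))"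
proof -
  define K where "K = pi * c powr (1 / q) * csc (pi / q)"
  \<comment> \<open>As \<open>q > 1\<close>, the angle lies strictly between 0 and
    \<open>pi\<close>. The constant must be nonzero because the equivalence is shown as a limit of
    quotients.\<close>
  have "sin (pi / q) > 0" using q by (intro sin_gt_zero) (auto simp: field_simps)
  then have K: "K > 0" using c by (simp add: K_def csc_def)
  have a_nonneg: "a j \<ge> 0" if "j \<ge> 1" for j using a_def[OF that] by simp
  note S = sum_ln_one_plus_asymp[OF a_nonneg q c a_asymp, folded K_def]
  have I: "((\<lambda>n. 2 * seq_mutual_info M \<kappa> \<theta> \<epsilon> n) \<sim>[at_top] (\<lambda>n. K * n powr (1 / q)))"
  proof (rule asymp_equivI')
    have "((\<lambda>n. n powr (- 1 / q) * (\<Sum>j. ln (1 + n * a (Suc j))) / K) \<longlongrightarrow> K / K) at_top"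
      using K by (intro tendsto_divide S(2) tendsto_const) auto
    moreover have "\<forall>\<^sub>F n in at_top. n powr (- 1 / q) * (\<Sum>j. ln (1 + n * a (Suc j))) / K
        = 2 * seq_mutual_info M \<kappa> \<theta> \<epsilon> n / (K * n powr (1 / q))"
      using eventually_gt_at_top[of 0]
    proof eventually_elim
      case (elim n)
      have "2 * seq_mutual_info M \<kappa> \<theta> \<epsilon> n = (\<Sum>j. ln (1 + n * a (Suc j)))"
        by (intro sums_unique seq_mutual_info_sums[OF prob \<kappa>_pos \<tau>_pos \<sigma>_pos prior noise indep a_def S(1) elim])
      then show ?case using elim by (simp add: powr_minus_divide)
    qed
    ultimately have "((\<lambda>n. 2 * seq_mutual_info M \<kappa> \<theta> \<epsilon> n / (K * n powr (1 / q))) \<longlongrightarrow> K / K) at_top"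
      by (rule Lim_transform_eventually)
    then show "((\<lambda>n. 2 * seq_mutual_info M \<kappa> \<theta> \<epsilon> n / (K * n powr (1 / q))) \<longlongrightarrow> 1) at_top"
      using K by simp
  qed
  have "(\<lambda>n. 2 * seq_mutual_info M \<kappa> \<theta> \<epsilon> n / ln n) \<sim>[at_top] (\<lambda>n. K * n powr (1 / q) / ln n)"
    by (intro asymp_equiv_intros I)
  then have "eff_dim M \<kappa> \<theta> \<epsilon> \<sim>[at_top] (\<lambda>n. K * (n powr (1 / q) / ln n))"
    by (simp add: eff_dim_def[abs_def])
  with I show ?thesis unfolding K_def by blast
qed

end
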